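(* Let $Y$ be the affine curve (of genus 5) over $\mathbb{Q}$ in coordinates $(q,y,z)$ defined by \[ y^2 = (5q^2-1)(q^2+3), \qquad z^2 = 5q^4-8q^3+6q^2+8q+5. \] Then $Y(\mathbb{Q},2) = Y(\mathbb{Q}) = \{(\pm1,\pm4,\pm4)\}$.
   Context: For a curve $X$ defined over $\mathbb{Q}$, $X(\mathbb{Q},2)$ denotes the set of points $P \in X(\overline{\mathbb{Q}})$ with $[\mathbb{Q}(P):\mathbb{Q}] \le 2$. Sign choices are independent. *)

theory Defs
  imports Complex_Main "HOL-Algebra.Algebraic_Closure_Type" "HOL-Algebra.Generated_Fields"
begin

text \<open>
  The algebraic closure of the rationals is realised as the field of algebraic numbers
  inside the complex numbers; an affine curve in 3-space over \<open>\<rat>\<close> is represented by its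
  assignment of point sets \<open>K \<mapsto> C(K)\<close> to the subfields \<open>K\<close> of \<open>\<complex>\<close>.
\<close>

type_synonym point = "complex \<times> complex \<times> complex"

definition Qbar :: "complex set" where
  "Qbar = {x. algebraic x}"

abbreviation complex_field :: "complex ring" where
  "complex_field \<equiv> ring_of_type_algebra"

text \<open>The field \<open>\<rat>(P)\<close>; a subfield of \<open>\<complex>\<close> contains \<open>\<rat>\<close>, so \<open>\<rat>\<close> need not be adjoined.\<close>

fun residue_field :: "point \<Rightarrow> complex set" where
  "residue_field (q, y, z) = generate_field complex_field {q, y, z}"

text \<open>
  \<open>[K : \<rat>] \<le> d\<close>. The relational \<^const>\<open>ring.dimension\<close> is used because it only holds for
  finite-dimensional \<open>K\<close>, whereas \<^const>\<open>ring.dim\<close> is unspecified in infinite dimension.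
\<close>

definition degree_over_Q_le :: "complex set \<Rightarrow> nat \<Rightarrow> bool" where
  "degree_over_Q_le K d \<longleftrightarrow> (\<exists>n\<le>d. ring.dimension complex_field n \<rat> K)"

text \<open>Commonly written \<open>C(\<rat>, d)\<close>; the points range over the algebraic closure.\<close>

definition points_of_degree_le :: "(complex set \<Rightarrow> point set) \<Rightarrow> nat \<Rightarrow> point set" where
  "points_of_degree_le C d = {P \<in> C Qbar. degree_over_Q_le (residue_field P) d}"

definition Y :: "complex set \<Rightarrow> point set" where
  "Y K = {(q, y, z). q \<in> K \<and> y \<in> K \<and> z \<in> K \<and>
     y^2 = (5 * q^2 - 1) * (q^2 + 3) \<and>
     z^2 = 5 * q^4 - 8 * q^3 + 6 * q^2 + 8 * q + 5}"

end

theory Submission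
  imports Defs "HOL-Computational_Algebra.Nth_Powers"
begin

text \<open>
  The two equations define elliptic curves of conductors 15 and 17 with four rational points each;
  finiteness is shown by 2-isogeny descents. Let \<open>(q, y, z)\<close> have degree at most two. If \<open>q\<close> is
  rational and \<open>y\<close>, \<open>z\<close> are not, then the product of the two quartics is a rational square at \<open>q\<close>;
  their resultant has only the prime factors 2 and 5, and a descent excludes the twist by 5, so each
  of them is a square. If \<open>q\<close> is a root of an irreducible \<open>x\<^sup>2 + Ax + B\<close>, the parabola through \<open>(1, 4)\<close>, \<open>(q, y)\<close> and the
  conjugate point meets the first curve in a fourth, hence known, rational point. This confines
  \<open>(A, B)\<close> to a line or a conic, likewise for the second curve, and at the intersection points of
  these \<open>x\<^sup>2 + Ax + B\<close> is reducible.
\<close>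

section \<open>Parametrising sums of two squares\<close>

text \<open>Over a field of degree at most two every coordinate is a rational combination of 1 and
  any irrational coordinate. For rational \<open>q\<close> the two quotient curves alone do not
  suffice: \<open>z = b*y\<close> with irrational \<open>y\<close> gives a rational point on the
  curve whose right-hand side is the product of the quartics. Parity and positivity remove 2 and -1
  from the common square classes of the two factors, so 5 alone needs a descent of its own. For
  irrational \<open>q\<close>, both quartics take the value 16 at 1 and -1, so one family with two
  parameters treats both. Their leading coefficient 5 is not a rational square, so a rational
  parabola always meets the curve in four affine points. All descents share one mechanism:
  Pythagorean-type parametrisations lead to a product written in two ways, and this to an integer
  \<open>c\<close> dividing a small determinant. Congruences and signs leave few values of
  \<open>c\<close>; a surviving one gives a smaller solution.\<close>

lemma coprime_mult_eq_square:
  fixes a b c :: int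
  assumes "coprime a b" "a * b = c^2" "a \<ge> 0" "b \<ge> 0"
  obtains u v where "a = u^2" "b = v^2" "c = u * v"
proof -
  have sq: "\<exists>u. x = u^2" if "coprime x y" "x * y = c^2" "x \<ge> 0" "y \<ge> 0" for x y :: int
  proof -
    have "nat x * nat y = (nat \<bar>c\<bar>)^2"
      using that(2,3) by (simp add: nat_abs_mult_distrib power2_eq_square flip: nat_mult_distrib)
    then have "is_nth_power 2 (nat x * nat y)" by simp
    moreover have "coprime (nat x) (nat y)"
      using that(1,3,4) coprime_int_iff[of "nat x" "nat y"] by simp
    ultimately have "is_nth_power 2 (nat x)"
      using is_nth_power_mult_coprime_nat_iff by blast
    then obtain k where "nat x = k^2" by (auto elim: is_nth_powerE)
    then have "x = (int k)^2" using that(3) by (metis int_nat_eq of_nat_power)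
    then show ?thesis by blast
  qed
  obtain u v where uv: "a = u^2" "b = v^2"
    using sq[of a b] sq[of b a] assms by (metis coprime_commute mult.commute)
  then have "c^2 = (u * v)^2" using assms(2) by (simp add: power_mult_distrib)
  then consider "c = u * v" | "c = (-u) * v" by (auto simp: power2_eq_iff)
  then show ?thesis
    using that[of u v] that[of "-u" v] uv by cases auto
qed

lemma odd_square_8:
  fixes x :: int
  assumes "odd x"
  obtains k where "x^2 = 8 * k + 1"
proof -
  obtain m where m: "x = 2 * m + 1" using assms by (auto elim: oddE)
  have "even (m * (m + 1))" by simp
  then obtain k where "m * (m + 1) = 2 * k" by blast
  then have "x^2 = 8 * k + 1" unfolding m by (simp add: power2_eq_square algebra_simps)
  then show ?thesis by (rule that)
qed

lemma sum_odd_squares_not_square: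
  fixes x y z :: int
  assumes "odd x" "odd y"
  shows "x^2 + y^2 \<noteq> z^2"
proof
  assume eq: "x^2 + y^2 = z^2"
  obtain k where k: "x^2 = 8 * k + 1" using assms(1) by (rule odd_square_8)
  obtain l where l: "y^2 = 8 * l + 1" using assms(2) by (rule odd_square_8)
  have "even (z^2)" using eq assms by (metis even_add even_power)
  then have "even z" by simp
  then obtain w where "z = 2 * w" by (auto elim: evenE)
  then have "8 * k + 1 + (8 * l + 1) = 4 * w^2" using eq k l by (simp add: power2_eq_square)
  then show False by presburger
qed

text \<open>The halves of \<open>|z| + x\<close> and \<open>|z| - x\<close> are coprime with product
  \<open>(y/2)^2\<close>, hence both are squares. The sign of \<open>z\<close> is arbitrary, so only
  its absolute value is parametrised.\<close>

lemma primitive_pythagorean: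
  fixes x y z :: int
  assumes eq: "x^2 + y^2 = z^2" and cop: "coprime x y" and x: "odd x"
  obtains a b where "x = a^2 - b^2" "y = 2 * a * b" "\<bar>z\<bar> = a^2 + b^2" "coprime a b"
proof -
  have "even y" using sum_odd_squares_not_square[of x y z] eq x by auto
  then obtain y' where y': "y = 2 * y'" by (auto elim: evenE)
  have "odd (z^2)" unfolding eq[symmetric] using x \<open>even y\<close> by simp
  then have "odd z" by simp
  define h k where "h = (\<bar>z\<bar> + x) div 2" and "k = (\<bar>z\<bar> - x) div 2"
  have "2 * h = \<bar>z\<bar> + x" "2 * k = \<bar>z\<bar> - x"
    unfolding h_def k_def using x \<open>odd z\<close> by simp_all
  then have hk: "\<bar>z\<bar> = h + k" "x = h - k" by linarith+
  have zz: "(h + k)^2 = z^2" using hk(1) by (metis power2_abs)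
  have "(h + k)^2 = (h - k)^2 + (2 * y')^2" using eq zz unfolding hk(2) y' by simp
  then have "4 * (h * k) = 4 * y'^2" by (simp add: power2_eq_square algebra_simps)
  then have prod: "h * k = y'^2" by simp
  have "\<bar>x\<bar> \<le> \<bar>z\<bar>"
    unfolding abs_le_square_iff using eq zero_le_power2[of y] by linarith
  then have nonneg: "h \<ge> 0" "k \<ge> 0" using hk by linarith+
  have "coprime h k"
  proof (rule coprimeI)
    fix d assume d: "d dvd h" "d dvd k"
    have "d dvd x" unfolding hk(2) using d by simp
    moreover have "d dvd y^2" using d prod unfolding y'
      by (metis dvd_mult dvd_mult2 power_mult_distrib)
    moreover have "coprime x (y^2)" using cop by simp
    ultimately show "is_unit d" using coprime_common_divisor by blast
  qed
  from coprime_mult_eq_square[OF this prod nonneg]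
  obtain a b where ab: "h = a^2" "k = b^2" "y' = a * b" .
  have "coprime a b" using \<open>coprime h k\<close> unfolding ab by simp
  then show ?thesis using that[of a b] hk ab y' by simp
qed

text \<open>Euler's four number theorem, with \<open>g\<close> the gcd of \<open>a\<close> and
  \<open>c\<close>. It turns a product written in two ways into a relation whose coefficients are
  squares, ready for \<open>square_ratio\<close>.\<close>

lemma four_number:
  fixes a b c d :: int
  assumes "a * b = c * d" "a \<noteq> 0" "c \<noteq> 0"
  obtains g h i j where "a = g * h" "b = i * j" "c = g * i" "d = h * j" "coprime h i"
proof -
  have "gcd a c \<noteq> 0" using assms(2) by simp
  then obtain h i where hi: "a = h * gcd a c" "c = i * gcd a c" "coprime h i"
    using gcd_coprime_exists by blast
  have "h * gcd a c * b = i * gcd a c * d" using assms(1) hi(1,2) by simp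
  then have "gcd a c * (h * b) = gcd a c * (i * d)" by (simp only: mult_ac)
  then have "h * b = i * d" unfolding mult_left_cancel[OF \<open>gcd a c \<noteq> 0\<close>] .
  then have "i dvd b" using hi(3) by (metis coprime_commute coprime_dvd_mult_right_iff dvd_triv_left)
  then obtain j where j: "b = i * j" by blast
  have "i \<noteq> 0" using hi(2) assms(3) by auto
  then have "d = h * j" using \<open>h * b = i * d\<close> j by simp
  then show ?thesis using that[of "gcd a c" h i j] hi j by (simp add: mult.commute)
qed

lemma square_ratio:
  fixes g j P Q :: int
  assumes "g^2 * P = j^2 * Q" "coprime g j" "g \<noteq> 0"
  obtains c where "P = c * j^2" "Q = c * g^2"
proof -
  have "g^2 dvd j^2 * Q" using assms(1) by (metis dvd_triv_left)
  then have "g^2 dvd Q" using assms(2) by (metis coprime_dvd_mult_right_iff coprime_power_left_iff coprime_power_right_iff)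
  then obtain c where c: "Q = g^2 * c" by blast
  then have "P = c * j^2" using assms(1,3) by simp
  then show ?thesis using that[of c] c by (simp add: mult.commute)
qed

text \<open>Used with \<open>D\<close> the determinant of the two relations produced by
  \<open>square_ratio\<close>, solved for two coprime squares. Only the divisors of \<open>D\<close>
  remain as values of \<open>c\<close>.\<close>

lemma dvd_of_coprime_squares:
  fixes c D h i :: int
  assumes "c dvd D * i^2" "c dvd D * h^2" "coprime h i"
  shows "c dvd D"
proof -
  have "c dvd gcd (D * i^2) (D * h^2)" using assms(1,2) by simp
  also have "gcd (D * i^2) (D * h^2) = \<bar>D\<bar> * gcd (i^2) (h^2)" by (simp add: gcd_mult_left abs_mult)
  also have "gcd (i^2) (h^2) = 1"
    using assms(3) by (simp add: coprime_commute flip: coprime_iff_gcd_eq_1)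
  finally show ?thesis by simp
qed

text \<open>\<open>(g, 4*j, h)\<close> is a primitive Pythagorean triple, so
  \<open>2*j = a*b\<close>. Halving the even one of \<open>a\<close> and \<open>b\<close> produces
  the shape \<open>\<alpha>^2 + 4*\<beta>^2\<close> of the quartic to which the descent
  returns.\<close>

lemma difference_16_squares:
  fixes g h j :: int
  assumes eq: "h^2 = g^2 + 16 * j^2" and g: "odd g" and cop: "coprime g j"
  obtains \<alpha> \<beta> where "j = \<alpha> * \<beta>" "h^2 = (\<alpha>^2 + 4 * \<beta>^2)^2" "coprime \<alpha> \<beta>" "odd \<alpha>"
proof -
  have "g^2 + (4 * j)^2 = h^2" using eq by (simp add: power_mult_distrib)
  moreover have "coprime g (2 * (2 * j))"
    using g cop unfolding coprime_mult_right_iff by simp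
  then have "coprime g (4 * j)" by simp
  ultimately obtain a b
    where ab: "g = a^2 - b^2" "4 * j = 2 * a * b" "\<bar>h\<bar> = a^2 + b^2" "coprime a b"
    using g by (rule primitive_pythagorean)
  have j: "2 * j = a * b" using ab(2) by simp
  have h: "h^2 = (a^2 + b^2)^2" using ab(3) by (metis power2_abs)
  have "even (a * b)" using j by (metis dvd_triv_left)
  then consider "even b" "odd a" | "even a" "odd b" using ab(1) g by auto
  then show ?thesis
  proof cases
    case 1
    then obtain \<beta> where "b = 2 * \<beta>" by blast
    then show ?thesis using that[of a \<beta>] j h ab(4) 1 by (simp add: power_mult_distrib)
  next
    case 2
    then obtain \<beta> where "a = 2 * \<beta>" by blast
    then show ?thesis using that[of b \<beta>] j h ab(4) 2
      by (simp add: power_mult_distrib add.commute mult.commute coprime_commute)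
  qed
qed

section \<open>Two descents\<close>

lemma coprime_square_add:
  fixes x y k :: int
  assumes "coprime x y" "coprime x k"
  shows "coprime (x^2 + k * y^2) (x * y)"
proof -
  have "gcd x (x * x + k * y^2) = gcd x (k * y^2)" by (rule gcd_add_mult)
  moreover have "gcd y (k * y * y + x^2) = gcd y (x^2)" by (rule gcd_add_mult)
  ultimately have "coprime x (x * x + k * y^2)" "coprime y (k * y * y + x^2)"
    using assms by (simp_all add: coprime_iff_gcd_eq_1 [symmetric] coprime_commute)
  then show ?thesis by (simp add: power2_eq_square coprime_commute algebra_simps)
qed

text \<open>A local obstruction: \<open>x*y = (a - b)*(a + b)\<close> leads to a divisor
  \<open>c\<close> of 17 that is 5 modulo 8, and there is none. It closes the branches of the
  17-case that admit no descent.\<close>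

lemma odd_quartic_not_square:
  fixes x y z :: int
  assumes "odd x" "odd y" and cop: "coprime x y"
  shows "z^2 \<noteq> 4 * (x^2 + y^2)^2 + x^2 * y^2"
proof
  assume "z^2 = 4 * (x^2 + y^2)^2 + x^2 * y^2"
  then have eq: "(x * y)^2 + (2 * (x^2 + y^2))^2 = z^2"
    by (simp only: power_mult_distrib) simp
  have "coprime (x * y) (x^2 + y^2)"
    using coprime_square_add[OF cop, of 1] by (simp add: coprime_commute)
  moreover have "coprime (x * y) 2" using assms(1,2) by simp
  ultimately have "coprime (x * y) (2 * (x^2 + y^2))"
    unfolding coprime_mult_right_iff[of _ 2] by blast
  with eq obtain a b where ab: "x * y = a^2 - b^2" "2 * (x^2 + y^2) = 2 * a * b" "coprime a b"
    by (rule primitive_pythagorean) (use assms(1,2) in auto)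
  have "odd (a^2 - b^2)" using assms(1,2) unfolding ab(1)[symmetric] by simp
  then have odd_ab: "odd (a - b)" by simp
  have "x * y = (a - b) * (a + b)" unfolding ab(1) by (simp add: power2_eq_square algebra_simps)
  moreover have "x \<noteq> 0" "a - b \<noteq> 0" using assms(1) odd_ab by auto
  ultimately obtain g h i j where ghij: "x = g * h" "y = i * j" "a - b = g * i" "a + b = h * j" "coprime h i"
    by (rule four_number)
  have odds: "odd g" "odd h" "odd i" "odd j" using assms(1,2) unfolding ghij by simp_all
  have "4 * (x^2 + y^2) = (a + b)^2 - (a - b)^2"
    using ab(2) by (simp add: power2_eq_square algebra_simps)
  then have "h^2 * (j^2 - 4 * g^2) = i^2 * (g^2 + 4 * j^2)"
    unfolding ghij by (simp add: power2_eq_square algebra_simps)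
  moreover have "h \<noteq> 0" using odds by auto
  ultimately obtain c where c: "j^2 - 4 * g^2 = c * i^2" "g^2 + 4 * j^2 = c * h^2"
    using ghij(5) square_ratio by metis
  have "coprime j g" using cop unfolding ghij by (simp add: coprime_commute)
  \<comment> \<open>The two relations are solved for \<open>g^2\<close> and \<open>j^2\<close>; 17
    is their determinant \<open>1*1 + 4*4\<close>.\<close>
  moreover have "17 * g^2 = c * (h^2 - 4 * i^2)" "17 * j^2 = c * (i^2 + 4 * h^2)"
    using c by (simp_all add: algebra_simps)
  then have "c dvd 17 * g^2" "c dvd 17 * j^2" by simp_all
  ultimately have "c dvd 17" by (rule dvd_of_coprime_squares[rotated 2])
  obtain G where G: "g^2 = 8 * G + 1" using odds(1) by (rule odd_square_8)
  obtain I where I: "i^2 = 8 * I + 1" using odds(3) by (rule odd_square_8)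
  obtain J where J: "j^2 = 8 * J + 1" using odds(4) by (rule odd_square_8)
  have "c = 8 * (J - 4 * G - c * I) - 3"
    using c(1) unfolding G I J by (simp add: algebra_simps)
  then have "c mod 8 = 5" by presburger
  moreover have "\<bar>c\<bar> \<le> 17" using \<open>c dvd 17\<close> by (simp add: zdvd_imp_le)
  ultimately have "c \<in> {-11, -3, 5, 13}" unfolding insert_iff empty_iff by presburger
  then show False using \<open>c dvd 17\<close> by auto
qed

text \<open>Disposes of \<open>c = 1\<close> in \<open>descent_17\<close>. Parametrising the first
  equation by \<open>p\<close>, \<open>q\<close> and taking \<open>p + q\<close>,
  \<open>p - q\<close> as variables turns the second into the quartic of
  \<open>odd_quartic_not_square\<close>.\<close>

lemma square_plus_16_square_and_sum:
  fixes g h i j :: int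
  assumes eqs: "i^2 = h^2 + j^2" "g^2 = h^2 + 16 * i^2"
    and h: "odd h" and cop: "coprime h i"
  shows False
proof -
  have "coprime (h^2) (i^2)" using cop by simp
  then have "coprime (h^2) (j^2)"
    unfolding eqs(1) by (simp add: coprime_iff_gcd_eq_1)
  then have "coprime h j" by simp
  with eqs(1)[symmetric] obtain p q
    where pq: "h = p^2 - q^2" "j = 2 * p * q" "\<bar>i\<bar> = p^2 + q^2" "coprime p q"
    using h by (rule primitive_pythagorean)
  have "odd (p + q)" "odd (p - q)" using h unfolding pq(1) by simp_all
  moreover have "coprime (p + q) (p - q)"
  proof (rule coprimeI)
    fix d assume d: "d dvd p + q" "d dvd p - q"
    then have "odd d" using \<open>odd (p + q)\<close> by (meson dvd_trans)
    have "d dvd 2 * p" "d dvd 2 * q"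
      using dvd_add[OF d] dvd_diff[OF d] by (simp_all add: algebra_simps)
    then have "d dvd p" "d dvd q"
      using \<open>odd d\<close> by (simp_all add: coprime_dvd_mult_right_iff)
    then show "is_unit d" using pq(4) coprime_common_divisor by blast
  qed
  moreover have "i^2 = (p^2 + q^2)^2" using pq(3) by (metis power2_abs)
  then have "g^2 = 4 * ((p + q)^2 + (p - q)^2)^2 + (p + q)^2 * (p - q)^2"
    using eqs(2) unfolding pq(1) by (simp add: power2_eq_square algebra_simps)
  ultimately show False using odd_quartic_not_square by blast
qed

lemma coprime_right_4_iff_odd: "coprime x 4 \<longleftrightarrow> odd x" for x :: int
  using coprime_power_right_iff[of x 2 2] by simp

lemma abs_less_abs_double_mult:
  fixes i x y :: int
  assumes "i \<noteq> 0" "x \<noteq> 0" "y \<noteq> 0"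
  shows "\<bar>y\<bar> < \<bar>2 * (i * (x * y))\<bar>"
proof -
  have "1 \<le> \<bar>i * x\<bar>" using assms(1,2) by (simp add: int_one_le_iff_zero_less)
  then have "1 * \<bar>y\<bar> \<le> \<bar>i * x\<bar> * \<bar>y\<bar>" by (rule mult_right_mono) simp
  then show ?thesis using assms(3) by (simp add: abs_mult mult.assoc)
qed

text \<open>Infinite descent on \<open>|e|\<close>. Here \<open>c\<close> divides 17 and is 1 modulo
  8. The value 1 is impossible; 17 gives \<open>i^2 = g^2 + j^2\<close> with
  \<open>g^2 = (\<alpha>^2 + 4*\<beta>^2)^2\<close> and \<open>j = \<alpha>*\<beta>\<close>, the
  same equation for \<open>\<alpha>\<close>, \<open>\<beta>\<close>, where
  \<open>e = 2*i*\<alpha>*\<beta>\<close>.\<close>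

lemma descent_17:
  fixes M e N :: int
  assumes "odd M" "coprime M e" "N^2 = (M^2 + 4 * e^2)^2 + (M * e)^2"
  shows "e = 0"
  using assms
proof (induction "nat \<bar>e\<bar>" arbitrary: M e N rule: less_induct)
  case less
  note M = less.prems(1) and cop = less.prems(2) and eq = less.prems(3)
  show "e = 0"
  proof (rule ccontr)
    assume "e \<noteq> 0"
    have X: "odd (M^2 + 4 * e^2)" using M by simp
    then have "even (M * e)" using sum_odd_squares_not_square eq by metis
    then have "even e" using M by simp
    then obtain f where f: "e = 2 * f" by blast
    have "coprime (M^2 + 4 * e^2) (M * e)"
      using coprime_square_add[of M e "4"] cop M coprime_right_4_iff_odd[of M] by simp
    from primitive_pythagorean[OF eq[symmetric] this X]
    obtain a b where ab: "M^2 + 4 * e^2 = a^2 - b^2" "M * e = 2 * a * b" .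
    have Mf: "M * f = a * b" using ab(2) f by simp
    have "M \<noteq> 0" "a \<noteq> 0" using M Mf f \<open>e \<noteq> 0\<close> by auto
    with Mf obtain g h i j where ghij: "M = g * h" "f = i * j" "a = g * i" "b = h * j" "coprime h i"
      by (rule four_number)
    have odds: "odd g" "odd h" using M unfolding ghij by simp_all
    have "g^2 * (i^2 - h^2) = j^2 * (h^2 + 16 * i^2)"
      using ab(1) unfolding f ghij by (simp add: power2_eq_square algebra_simps)
    moreover have "coprime g j" using cop unfolding ghij f by simp
    moreover have "g \<noteq> 0" using odds by auto
    ultimately obtain c where c: "i^2 - h^2 = c * j^2" "h^2 + 16 * i^2 = c * g^2"
      by (rule square_ratio)
    have c17: "17 * i^2 = c * (g^2 + j^2)" "17 * h^2 = c * (g^2 - 16 * j^2)"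
      using c by (simp_all add: algebra_simps)
    then have "c dvd 17 * i^2" "c dvd 17 * h^2" by simp_all
    then have "c dvd 17" using ghij(5) by (rule dvd_of_coprime_squares)
    obtain G where G: "g^2 = 8 * G + 1" using odds(1) by (rule odd_square_8)
    obtain H where H: "h^2 = 8 * H + 1" using odds(2) by (rule odd_square_8)
    have "c = 8 * (H + 2 * i^2 - c * G) + 1"
      using c(2) unfolding G H by (simp add: algebra_simps)
    then have "c mod 8 = 1" by presburger
    moreover have "\<bar>c\<bar> \<le> 17" using \<open>c dvd 17\<close> by (simp add: zdvd_imp_le)
    ultimately have "c \<in> {-15, -7, 1, 9, 17}" unfolding insert_iff empty_iff by presburger
    then consider "c = 1" | "c = 17" using \<open>c dvd 17\<close> by auto
    then show False
    proof cases
      case 1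
      then show False
        using square_plus_16_square_and_sum[of i h j g] c odds(2) ghij(5) by simp
    next
      case 2
      then have gj: "i^2 = g^2 + j^2" "g^2 = h^2 + 16 * j^2" using c17 by simp_all
      have "coprime (j^2) (g^2)" using \<open>coprime g j\<close> by (simp add: coprime_commute)
      moreover have "gcd (j^2) (g^2) = gcd (j^2) (h^2)"
        using gcd_add_mult[of "j^2" 16 "h^2"] gj(2) by (simp add: add.commute)
      ultimately have "coprime (h^2) (j^2)" unfolding coprime_iff_gcd_eq_1 by (simp add: gcd.commute)
      then have "coprime h j" by simp
      with gj(2) odds(2) obtain \<alpha> \<beta>
        where ab: "j = \<alpha> * \<beta>" "g^2 = (\<alpha>^2 + 4 * \<beta>^2)^2" "coprime \<alpha> \<beta>" "odd \<alpha>"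
        by (rule difference_16_squares)
      have "i^2 = (\<alpha>^2 + 4 * \<beta>^2)^2 + (\<alpha> * \<beta>)^2" using gj(1) ab by simp
      moreover have "nat \<bar>\<beta>\<bar> < nat \<bar>e\<bar>"
        using abs_less_abs_double_mult[of i \<alpha> \<beta>] \<open>e \<noteq> 0\<close> unfolding f ghij ab by simp
      ultimately have "\<beta> = 0" using less.hyps ab(3,4) by blast
      then show False using \<open>e \<noteq> 0\<close> unfolding f ghij ab by simp
    qed
  qed
qed

text \<open>With the opposite sign the determinant becomes \<open>1 - 16\<close>. The divisors of 15
  that are 1 modulo 8 are 1, excluded by sign, and -15. The latter descends because
  \<open>(\<alpha>^2 + 4*\<beta>^2)^2 - 16*\<alpha>^2*\<beta>^2 = (\<alpha>^2 -
  4*\<beta>^2)^2\<close>.\<close>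

lemma descent_minus_15:
  fixes M e N :: int
  assumes "odd M" "coprime M e" "N^2 = (M^2 - 4 * e^2)^2 + (M * e)^2"
  shows "e = 0"
  using assms
proof (induction "nat \<bar>e\<bar>" arbitrary: M e N rule: less_induct)
  case less
  note M = less.prems(1) and cop = less.prems(2) and eq = less.prems(3)
  show "e = 0"
  proof (rule ccontr)
    assume "e \<noteq> 0"
    have X: "odd (M^2 - 4 * e^2)" using M by simp
    then have "even (M * e)" using sum_odd_squares_not_square eq by metis
    then have "even e" using M by simp
    then obtain f where f: "e = 2 * f" by blast
    have "coprime (M^2 - 4 * e^2) (M * e)"
      using coprime_square_add[of M e "-4"] cop M coprime_right_4_iff_odd[of M] by simp
    from primitive_pythagorean[OF eq[symmetric] this X]
    obtain a b where ab: "M^2 - 4 * e^2 = a^2 - b^2" "M * e = 2 * a * b" .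
    have Mf: "M * f = a * b" using ab(2) f by simp
    have "M \<noteq> 0" "a \<noteq> 0" using M Mf f \<open>e \<noteq> 0\<close> by auto
    with Mf obtain g h i j where ghij: "M = g * h" "f = i * j" "a = g * i" "b = h * j" "coprime h i"
      by (rule four_number)
    have odds: "odd g" "odd h" using M unfolding ghij by simp_all
    have "g^2 * (i^2 - h^2) = j^2 * (h^2 - 16 * i^2)"
      using ab(1) unfolding f ghij by (simp add: power2_eq_square algebra_simps)
    moreover have "coprime g j" using cop unfolding ghij f by simp
    moreover have "g \<noteq> 0" using odds by auto
    ultimately obtain c where c: "i^2 - h^2 = c * j^2" "h^2 - 16 * i^2 = c * g^2"
      by (rule square_ratio)
    have c15: "15 * i^2 = (- c) * (g^2 + j^2)" "15 * h^2 = (- c) * (g^2 + 16 * j^2)"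
      using c by (simp_all add: algebra_simps)
    then have "- c dvd 15 * i^2" "- c dvd 15 * h^2" by (metis dvd_triv_left)+
    then have "c dvd 15" using ghij(5) dvd_of_coprime_squares minus_dvd_iff by metis
    obtain G where G: "g^2 = 8 * G + 1" using odds(1) by (rule odd_square_8)
    obtain H where H: "h^2 = 8 * H + 1" using odds(2) by (rule odd_square_8)
    have "c = 8 * (H - 2 * i^2 - c * G) + 1"
      using c(2) unfolding G H by (simp add: algebra_simps)
    then have "c mod 8 = 1" by presburger
    moreover have "\<bar>c\<bar> \<le> 15" using \<open>c dvd 15\<close> by (simp add: zdvd_imp_le)
    ultimately have "c \<in> {-15, -7, 1, 9}" unfolding insert_iff empty_iff by presburger
    then consider "c = 1" | "c = - 15" using \<open>c dvd 15\<close> by auto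
    then show False
    proof cases
      case 1
      then have "15 * h^2 = - (g^2 + 16 * j^2)" using c15(2) by simp
      then have "15 * h^2 \<le> 0" using zero_le_power2[of g] zero_le_power2[of j] by linarith
      then have "h = 0" by (simp add: mult_le_0_iff)
      then show False using odds(2) by simp
    next
      case 2
      then have gj: "i^2 = g^2 + j^2" "h^2 = g^2 + 16 * j^2" using c15 by simp_all
      from gj(2) odds(1) \<open>coprime g j\<close> obtain \<alpha> \<beta>
        where ab: "j = \<alpha> * \<beta>" "h^2 = (\<alpha>^2 + 4 * \<beta>^2)^2" "coprime \<alpha> \<beta>" "odd \<alpha>"
        by (rule difference_16_squares)
      have "i^2 = (\<alpha>^2 - 4 * \<beta>^2)^2 + (\<alpha> * \<beta>)^2"
        using gj ab(1,2) by (simp add: power2_eq_square algebra_simps)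
      moreover have "nat \<bar>\<beta>\<bar> < nat \<bar>e\<bar>"
        using abs_less_abs_double_mult[of i \<alpha> \<beta>] \<open>e \<noteq> 0\<close> unfolding f ghij ab by simp
      ultimately have "\<beta> = 0" using less.hyps ab(3,4) by blast
      then show False using \<open>e \<noteq> 0\<close> unfolding f ghij ab by simp
    qed
  qed
qed

text \<open>
  The quartics are \<open>M\<^sup>4 + 9M\<^sup>2e\<^sup>2 + 16e\<^sup>4\<close> and \<open>M\<^sup>4 - 7M\<^sup>2e\<^sup>2 + 16e\<^sup>4\<close>; their discriminants
  involve \<open>9\<^sup>2 - 64 = 17\<close> and \<open>7\<^sup>2 - 64 = -15\<close>.
\<close>
lemma quartic_17_coprime:
  fixes M e N :: int
  assumes cop: "coprime M e" and eq: "N^2 = (M^2 + 4 * e^2)^2 + (M * e)^2"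
  shows "M = 0 \<or> e = 0"
proof (cases "odd M")
  case True
  then show ?thesis using descent_17 cop eq by blast
next
  case False
  then obtain m where m: "M = 2 * m" by blast
  have e: "odd e" using cop False by (meson coprime_common_divisor odd_one)
  have "even (N^2)" unfolding eq m by simp
  then have "even N" by simp
  then obtain n where n: "N = 2 * n" by blast
  have eq2: "n^2 = 4 * (m^2 + e^2)^2 + m^2 * e^2"
    using eq unfolding m n by (simp add: power2_eq_square algebra_simps)
  have cop2: "coprime m e" using cop unfolding m by simp
  then have "even m" using odd_quartic_not_square[of m e n] e eq2 by blast
  then obtain k where k: "m = 2 * k" by blast
  have "even (n^2)" unfolding eq2 k by simp
  then have "even n" by simp
  then obtain l where l: "n = 2 * l" by blast
  \<comment> \<open>The quartic reproduces itself with the odd \<open>e\<close> in the place of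
    \<open>M\<close> and \<open>k = M/4\<close> in the place of \<open>e\<close>.\<close>
  have "l^2 = (e^2 + 4 * k^2)^2 + (e * k)^2"
    using eq2 unfolding k l by (simp add: power2_eq_square algebra_simps)
  moreover have "coprime e k" using cop2 unfolding k by (simp add: coprime_commute)
  ultimately have "k = 0" using descent_17 e by blast
  then show ?thesis using m k by simp
qed

text \<open>Unlike in \<open>odd_quartic_not_square\<close>, the solution \<open>M^2 = e^2\<close>
  exists, so no congruence can exclude this case. The identity
  \<open>(M^2 + e^2)^2 = (M^2 - e^2)^2 + 4*(M*e)^2\<close>, rewritten in the parameters
  \<open>a\<close>, \<open>b\<close>, leads back to \<open>descent_minus_15\<close>.\<close>

lemma odd_minus_quartic:
  fixes M e N :: int
  assumes "odd M" "odd e" and cop: "coprime M e"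
    and eq: "N^2 = 4 * (M^2 - e^2)^2 + M^2 * e^2"
  shows "M^2 = e^2"
proof -
  have eq2: "(M * e)^2 + (2 * (M^2 - e^2))^2 = N^2"
    unfolding eq by (simp only: power_mult_distrib) simp
  have "coprime (M * e) (M^2 - e^2)"
    using coprime_square_add[OF cop, of "-1"] by (simp add: coprime_commute)
  moreover have "coprime (M * e) 2" using assms(1,2) by simp
  ultimately have "coprime (M * e) (2 * (M^2 - e^2))"
    unfolding coprime_mult_right_iff[of _ 2] by blast
  with eq2 obtain a b where ab: "M * e = a^2 - b^2" "2 * (M^2 - e^2) = 2 * a * b" "coprime a b"
    by (rule primitive_pythagorean) (use assms(1,2) in auto)
  have ab2: "M^2 - e^2 = a * b" using ab(2) by simp
  have "even (M^2 + e^2)" using assms(1,2) by simp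
  then obtain L where L: "M^2 + e^2 = 2 * L" by blast
  have "(M^2 + e^2)^2 = (M^2 - e^2)^2 + 4 * (M * e)^2"
    by (simp add: power2_eq_square algebra_simps)
  then have LL: "4 * L^2 = (a * b)^2 + 4 * (a^2 - b^2)^2"
    unfolding L ab2 ab(1) by (simp add: power_mult_distrib)
  have "odd (a^2 - b^2)" unfolding ab(1)[symmetric] using assms(1,2) by simp
  have zero: "y = 0" if "odd x" "coprime x (2 * y)" "4 * L^2 = (x * (2 * y))^2 + 4 * (x^2 - (2 * y)^2)^2" for x y
    using descent_minus_15[of x y L] that by (simp add: power_mult_distrib)
  have "even (M^2 - e^2)" using assms(1,2) by simp
  then have "even (a * b)" using ab2 by simp
  then consider "even b" "odd a" | "even a" "odd b" using \<open>odd (a^2 - b^2)\<close> by auto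
  then have "a * b = 0"
  proof cases
    case 1
    then obtain y where "b = 2 * y" by blast
    then show ?thesis using zero[of a y] 1 ab(3) LL by simp
  next
    case 2
    then obtain y where y: "a = 2 * y" by blast
    have "4 * L^2 = (b * (2 * y))^2 + 4 * (b^2 - (2 * y)^2)^2"
      using LL unfolding y by (simp add: power2_eq_square algebra_simps)
    then show ?thesis using zero[of b y] 2 ab(3) y by (simp add: coprime_commute)
  qed
  then have "M^2 - e^2 = 0" unfolding ab2 .
  then show ?thesis by simp
qed

lemma quartic_minus_15_coprime:
  fixes M e N :: int
  assumes cop: "coprime M e" and eq: "N^2 = (M^2 - 4 * e^2)^2 + (M * e)^2"
  shows "M = 0 \<or> e = 0 \<or> M^2 = 4 * e^2"
proof (cases "odd M")
  case True
  then show ?thesis using descent_minus_15 cop eq by blast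
next
  case False
  then obtain m where m: "M = 2 * m" by blast
  have e: "odd e" using cop False by (meson coprime_common_divisor odd_one)
  have "even (N^2)" unfolding eq m by simp
  then have "even N" by simp
  then obtain n where n: "N = 2 * n" by blast
  have eq2: "n^2 = 4 * (m^2 - e^2)^2 + m^2 * e^2"
    using eq unfolding m n by (simp add: power2_eq_square algebra_simps)
  have cop2: "coprime m e" using cop unfolding m by simp
  show ?thesis
  proof (cases "odd m")
    case True
    then have "m^2 = e^2" using odd_minus_quartic e cop2 eq2 by blast
    then show ?thesis unfolding m by (simp add: power_mult_distrib)
  next
    case False
    then obtain k where k: "m = 2 * k" by blast
    have "even (n^2)" unfolding eq2 k by simp
    then have "even n" by simp
    then obtain l where l: "n = 2 * l" by blast
    have "l^2 = (e^2 - 4 * k^2)^2 + (e * k)^2"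
      using eq2 unfolding k l by (simp add: power2_eq_square algebra_simps)
    moreover have "coprime e k" using cop2 unfolding k by (simp add: coprime_commute)
    ultimately have "k = 0" using descent_minus_15 e by blast
    then show ?thesis using m k by simp
  qed
qed

section \<open>From coprime integers to rational arguments\<close>

lemma rat_square_eq_of_int:
  fixes w :: rat
  assumes "w^2 = of_int k"
  obtains N where "k = N^2"
proof -
  obtain a b where ab: "quotient_of w = (a, b)" by fastforce
  have b: "b > 0" "coprime a b" "w = of_int a / of_int b"
    using quotient_of_denom_pos[OF ab] quotient_of_coprime[OF ab] quotient_of_div[OF ab] by auto
  then have "w * of_int b = of_int a" by simp
  then have "of_int (a^2) = (w * of_int b)^2" by simp
  also have "\<dots> = of_int (k * b^2)" by (simp add: power_mult_distrib assms)
  finally have "(of_int (a^2) :: rat) = of_int (k * b^2)" .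
  then have eq: "a^2 = k * b^2" by (simp only: of_int_eq_iff)
  then have "b^2 dvd a^2" by simp
  moreover have "coprime (a^2) (b^2)" using b(2) by simp
  ultimately have "is_unit (b^2)" using coprime_common_divisor[of "a^2" "b^2" "b^2"] by simp
  then have "b^2 = 1" by (simp only: zdvd1_eq abs_power2)
  then show ?thesis using that[of a] eq by simp
qed

lemma rat_ratio_coprime:
  fixes x y :: rat
  assumes "y \<noteq> 0"
  obtains m n t where "x = of_int m * t" "y = of_int n * t" "coprime m n" "n \<noteq> 0" "t \<noteq> 0"
proof -
  obtain m n where mn: "quotient_of (x / y) = (m, n)" by fastforce
  have n: "n > 0" "coprime m n" "x / y = of_int m / of_int n"
    using quotient_of_denom_pos[OF mn] quotient_of_coprime[OF mn] quotient_of_div[OF mn] by auto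
  show ?thesis
    using that[of m "y / of_int n" n] n assms by (simp add: field_simps)
qed

lemma quartic_17_rat:
  fixes p r w :: rat
  assumes eq: "w^2 = (p^2 + 4 * r^2)^2 + (p * r)^2"
  shows "p = 0 \<or> r = 0"
proof (cases "r = 0")
  case False
  then obtain m n t where mn: "p = of_int m * t" "r = of_int n * t" "coprime m n" "t \<noteq> 0"
    by (rule rat_ratio_coprime)
  have "w^2 = of_int ((m^2 + 4 * n^2)^2 + (m * n)^2) * (t^2)^2"
    unfolding eq mn by (simp add: power2_eq_square algebra_simps)
  then have "(w / t^2)^2 = of_int ((m^2 + 4 * n^2)^2 + (m * n)^2)"
    using \<open>t \<noteq> 0\<close> by (simp add: power_divide)
  then obtain N where "(m^2 + 4 * n^2)^2 + (m * n)^2 = N^2" by (rule rat_square_eq_of_int)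
  then have "m = 0 \<or> n = 0" using quartic_17_coprime mn(3) by metis
  then show ?thesis using mn by auto
qed simp

lemma quartic_minus_15_rat:
  fixes p r w :: rat
  assumes eq: "w^2 = (p^2 - 4 * r^2)^2 + (p * r)^2"
  shows "p = 0 \<or> r = 0 \<or> p^2 = 4 * r^2"
proof (cases "r = 0")
  case False
  then obtain m n t where mn: "p = of_int m * t" "r = of_int n * t" "coprime m n" "t \<noteq> 0"
    by (rule rat_ratio_coprime)
  have "w^2 = of_int ((m^2 - 4 * n^2)^2 + (m * n)^2) * (t^2)^2"
    unfolding eq mn by (simp add: power2_eq_square algebra_simps)
  then have "(w / t^2)^2 = of_int ((m^2 - 4 * n^2)^2 + (m * n)^2)"
    using \<open>t \<noteq> 0\<close> by (simp add: power_divide)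
  then obtain N where "(m^2 - 4 * n^2)^2 + (m * n)^2 = N^2" by (rule rat_square_eq_of_int)
  then have "m = 0 \<or> n = 0 \<or> m^2 = 4 * n^2" using quartic_minus_15_coprime mn(3) by metis
  then show ?thesis
  proof (elim disjE)
    assume "m^2 = 4 * n^2"
    then have "(of_int (m^2) :: rat) = of_int (4 * n^2)" by (simp only:)
    then show ?thesis unfolding mn by (simp add: power_mult_distrib)
  qed (use mn in auto)
qed simp

section \<open>Rational points on the two elliptic quotients\<close>

text \<open>2 is a non-residue modulo 3, which serves for the irrationality of the square roots of
  both 5 and 17.\<close>

lemma rat_square_mod_3:
  fixes w :: rat
  assumes "k mod 3 = 2"
  shows "w^2 \<noteq> of_int k"
proof
  assume "w^2 = of_int k"
  then obtain N where N: "k = N^2" by (rule rat_square_eq_of_int)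
  define r where "r = N mod 3"
  have "r \<in> {0, 1, 2}" unfolding r_def by auto
  moreover have "k mod 3 = (r * r) mod 3" unfolding N r_def power2_eq_square by (simp add: mod_mult_eq)
  ultimately show False using assms by auto
qed

lemma curve_15_rat_points:
  fixes q y :: rat
  assumes eq: "y^2 = 5 * q^4 + 14 * q^2 - 3"
  shows "q^2 = 1 \<and> y^2 = 16"
proof -
  \<comment> \<open>the 2-isogeny \<open>X = (y / 2q)\<^sup>2\<close> to \<open>Y\<^sup>2 = X(X\<^sup>2 - 7X + 16)\<close>\<close>
  have "(5 * q^4 + 3)^2 = (y^2)^2 - 28 * y^2 * q^2 + 256 * q^4"
    unfolding eq by (simp add: power2_eq_square power4_eq_xxxx algebra_simps)
  also have "\<dots> = (y^2 - 4 * (2 * q)^2)^2 + (y * (2 * q))^2"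
    by (simp add: power2_eq_square power4_eq_xxxx algebra_simps)
  finally have "y = 0 \<or> 2 * q = 0 \<or> y^2 = 4 * (2 * q)^2" by (rule quartic_minus_15_rat)
  then have "q^2 = 1"
  proof (elim disjE)
    assume "y = 0"
    then have "(5 * q^2 - 1) * (q^2 + 3) = 0"
      using eq by (simp add: power2_eq_square power4_eq_xxxx algebra_simps)
    moreover have "q^2 + 3 > 0" by (simp add: add_nonneg_pos)
    ultimately have "(5 * q)^2 = of_int 5" by (simp add: power_mult_distrib)
    then show ?thesis using rat_square_mod_3[of 5 "5 * q"] by simp
  next
    assume "2 * q = 0"
    then show ?thesis using eq zero_le_power2[of y] by simp
  next
    assume "y^2 = 4 * (2 * q)^2"
    then have "(q^2 - 1) * (5 * q^2 + 3) = 0"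
      using eq by (simp add: power2_eq_square power4_eq_xxxx algebra_simps)
    moreover have "5 * q^2 + 3 > 0" by (simp add: add_nonneg_pos)
    ultimately show ?thesis by simp
  qed
  moreover have "y^2 = 5 * (q^2)^2 + 14 * q^2 - 3" using eq by (simp flip: power_mult)
  ultimately show ?thesis by simp
qed

text \<open>
  Translating by the point \<open>(-4, 4)\<close> of order four on \<open>y\<^sup>2 = x(x\<^sup>2 + 9x + 16)\<close> turns \<open>x = -(z/e)\<^sup>2\<close>
  into a square, which reduces to the positive quartic.
\<close>
lemma neg_quartic_17_rat:
  fixes z e N :: rat
  assumes N: "N^2 = 9 * z^2 * e^2 - (z^2)^2 - 16 * (e^2)^2"
  shows "z^2 = 4 * e^2"
proof -
  define x r where "x = N - z * e" and "r = 4 * e^2 - z^2"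
  have xr: "x^2 + r^2 = - 2 * z * e * x"
    using N unfolding x_def r_def by (simp add: power2_eq_square algebra_simps)
  have "((2 * x)^2 + 4 * r^2)^2 + (2 * x * r)^2 = 16 * (x^2 + r^2)^2 + (2 * x * r)^2"
    by (simp add: power2_eq_square algebra_simps)
  also have "\<dots> = (2 * x * (z^2 + 4 * e^2))^2"
    unfolding xr by (simp add: r_def power2_eq_square algebra_simps)
  finally have "2 * x = 0 \<or> r = 0" by (rule quartic_17_rat[OF sym])
  moreover have "r = 0" if "x = 0" using xr that by simp
  ultimately show ?thesis unfolding r_def by auto
qed

text \<open>The first identity says that \<open>x = -(z/(q^2 + 1))^2\<close> is the first coordinate
  of a rational point on \<open>y^2 = x*(x^2 + 9*x + 16)\<close>; \<open>neg_quartic_17_rat\<close>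
  then forces \<open>x = -4\<close>.\<close>

lemma curve_17_rat_points:
  fixes q z :: rat
  assumes eq: "z^2 = 5 * q^4 - 8 * q^3 + 6 * q^2 + 8 * q + 5"
  shows "q^2 = 1 \<and> z^2 = 16"
proof -
  have "(2 * (q^2 - 1)^2 + 2 * q * (q^2 - 1) - 8 * q^2)^2
      = 9 * z^2 * (q^2 + 1)^2 - (z^2)^2 - 16 * ((q^2 + 1)^2)^2"
    unfolding eq by (simp add: power2_eq_square power3_eq_cube power4_eq_xxxx algebra_simps)
  then have z: "z^2 = 4 * (q^2 + 1)^2" by (rule neg_quartic_17_rat)
  then have "(q^2 - 1) * (q^2 - 8 * q - 1) = 0"
    unfolding eq by (simp add: power2_eq_square power3_eq_cube power4_eq_xxxx algebra_simps)
  moreover have "q^2 - 8 * q - 1 \<noteq> 0"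
  proof
    assume "q^2 - 8 * q - 1 = 0"
    then have "(q - 4)^2 = of_int 17" by (simp add: power2_eq_square algebra_simps)
    then show False using rat_square_mod_3[of 17 "q - 4"] by simp
  qed
  ultimately have "q^2 = 1" by simp
  then show ?thesis using z by simp
qed

section \<open>A descent on the twist by 5\<close>

lemma prime_5_int: "prime (5 :: int)"
  by (rule prime_int_numeral_eq[THEN iffD2]) simp

lemma square_mod_5: "x^2 mod 5 \<in> {0, 1, 4 :: int}" "x^2 mod 5 = 0 \<longleftrightarrow> 5 dvd x"
proof -
  define r where "r = x mod 5"
  have "r \<in> {0, 1, 2, 3, 4}" unfolding r_def by auto
  moreover have "x^2 mod 5 = (r * r) mod 5" unfolding r_def power2_eq_square by (simp add: mod_mult_eq)
  ultimately show "x^2 mod 5 \<in> {0, 1, 4 :: int}" by auto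
  show "x^2 mod 5 = 0 \<longleftrightarrow> 5 dvd x"
    using prime_5_int by (simp add: prime_dvd_power_iff flip: dvd_eq_mod_eq_0)
qed

text \<open>Modulo 5, 3 is a non-residue and -1 is a residue.\<close>

lemma three_square_mod_5:
  fixes g h t :: int
  assumes "\<not> 5 dvd g"
  shows "3 * h^2 \<noteq> g^2 + 5 * t" "3 * h^2 \<noteq> 5 * t - g^2"
proof -
  have g: "g^2 mod 5 = 1 \<or> g^2 mod 5 = 4" using square_mod_5[of g] assms by auto
  have h: "h^2 mod 5 = 0 \<or> h^2 mod 5 = 1 \<or> h^2 mod 5 = 4" using square_mod_5(1)[of h] by auto
  have "3 * h^2 mod 5 = 3 * (h^2 mod 5) mod 5" by (simp add: mod_mult_right_eq)
  then have h3: "3 * h^2 mod 5 \<in> {0, 2, 3}" using h by auto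
  have disj: "{1, 4} \<inter> {0, 2, 3 :: int} = {}" by simp
  have "(g^2 + 5 * t) mod 5 \<in> {1, 4}" using g by auto
  then show "3 * h^2 \<noteq> g^2 + 5 * t" using h3 disj by (metis disjoint_iff)
  have "(5 * t - g^2) mod 5 = (5 * t - g^2 mod 5) mod 5" by (simp only: mod_diff_right_eq)
  also have "(5 * t - 1) mod 5 = 4" "(5 * t - 4) mod 5 = 1" by presburger+
  then have "(5 * t - g^2 mod 5) mod 5 \<in> {1, 4}" using g by (metis insert_iff)
  finally show "3 * h^2 \<noteq> 5 * t - g^2" using h3 disj by (metis disjoint_iff)
qed

text \<open>The halves of \<open>|w| - u\<close> and \<open>|w| + u\<close> are coprime with product
  \<open>5*k^2\<close>, so one is a square and the other five times a square; \<open>s\<close>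
  records which.\<close>

lemma difference_20_squares:
  fixes u k w :: int
  assumes eq: "w^2 = u^2 + 20 * k^2" and u: "odd u" "\<not> 5 dvd u" and cop: "coprime u k"
  obtains a b s where "k = a * b" "u = s * (a^2 - 5 * b^2)" "s = 1 \<or> s = -1" "coprime a b"
proof -
  have "odd (w^2)" unfolding eq using u(1) by simp
  then have w: "odd w" by simp
  define A B where "A = (\<bar>w\<bar> - u) div 2" and "B = (\<bar>w\<bar> + u) div 2"
  have "2 * A = \<bar>w\<bar> - u" "2 * B = \<bar>w\<bar> + u"
    unfolding A_def B_def using u(1) w by simp_all
  then have AB: "\<bar>w\<bar> = A + B" "u = B - A" by linarith+
  have "(A + B)^2 = (B - A)^2 + 20 * k^2"
    using eq unfolding AB(1)[symmetric] AB(2)[symmetric] by simp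
  then have prod: "A * B = 5 * k^2" by (simp add: power2_eq_square algebra_simps)
  have "\<bar>u\<bar> \<le> \<bar>w\<bar>"
    unfolding abs_le_square_iff using eq zero_le_power2[of k] by linarith
  then have nonneg: "A \<ge> 0" "B \<ge> 0" using AB by linarith+
  have "coprime A B"
  proof (rule coprimeI)
    fix d assume d: "d dvd A" "d dvd B"
    have du: "d dvd u" unfolding AB(2) using d by simp
    have "d dvd 5 * k^2" using d(1) prod by (metis dvd_mult2)
    moreover have "coprime u 5"
      using u(2) prime_5_int prime_imp_coprime coprime_commute by blast
    then have "coprime u (5 * k^2)" using cop by simp
    ultimately show "is_unit d" using du coprime_common_divisor[of u "5 * k^2" d] by blast
  qed
  have "5 dvd A * B" unfolding prod by simp
  then consider "5 dvd A" | "5 dvd B" using prime_5_int prime_dvd_mult_iff by blast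
  then show ?thesis
  proof cases
    case 1
    then obtain A' where A': "A = 5 * A'" by blast
    have "coprime A' B" "A' * B = k^2" "A' \<ge> 0"
      using \<open>coprime A B\<close> prod nonneg(1) unfolding A' by simp_all
    then obtain x y where xy: "A' = x^2" "B = y^2" "k = x * y"
      using nonneg(2) by (rule coprime_mult_eq_square)
    have "coprime y x" using \<open>coprime A' B\<close> unfolding xy by (simp add: coprime_commute)
    then show ?thesis using that[of y x 1] xy A' AB(2) by (simp add: mult.commute)
  next
    case 2
    then obtain B' where B': "B = 5 * B'" by blast
    have "coprime A B'" "A * B' = k^2" "B' \<ge> 0"
      using \<open>coprime A B\<close> prod nonneg(2) unfolding B' by simp_all
    then obtain x y where xy: "A = x^2" "B' = y^2" "k = x * y"
      using nonneg(1) coprime_mult_eq_square by metis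
    have "coprime x y" using \<open>coprime A B'\<close> unfolding xy by simp
    then show ?thesis using that[of x y "-1"] xy B' AB(2) by simp
  qed
qed

lemma square_ratio_5:
  fixes g j P Q :: int
  assumes "g^2 * P = j^2 * (5 * Q)" "coprime g j" "\<not> 5 dvd g"
  obtains c where "P = 5 * c * j^2" "Q = c * g^2"
proof -
  have "g \<noteq> 0" using assms(3) by auto
  with assms(1,2) obtain c where c: "P = c * j^2" "5 * Q = c * g^2"
    by (rule square_ratio)
  have "5 dvd c * g^2" using c(2) by (metis dvd_triv_left)
  then have "5 dvd c"
    using assms(3) prime_5_int prime_dvd_mult_iff prime_dvd_power by blast
  then obtain d where "c = 5 * d" by blast
  then show ?thesis using that[of d] c by simp
qed

text \<open>5 divides \<open>c\<close> because it does not divide \<open>g\<close>, and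
  \<open>c = 5\<close> or \<open>c = -5\<close> would contradict \<open>three_square_mod_5\<close>.
  The terms \<open>t\<close> and \<open>T\<close> stay free so that all four branches of
  \<open>descent_75\<close> can use it.\<close>

lemma ratio_15:
  fixes c g h i t T :: int
  assumes eqs: "15 * h^2 = c * (g^2 + 5 * t)" "15 * i^2 = c * T"
    and cop: "coprime h i" and g: "\<not> 5 dvd g"
  shows "c = 15 \<or> c = -15"
proof -
  have "c dvd 15 * i^2" "c dvd 15 * h^2" using eqs by simp_all
  then have "c dvd 15" using cop by (rule dvd_of_coprime_squares)
  have "c * g^2 = 5 * (3 * h^2 - c * t)" using eqs(1) by (simp add: algebra_simps)
  then have "5 dvd c * g^2" by simp
  then have "5 dvd c"
    using g prime_5_int prime_dvd_mult_iff prime_dvd_power by blast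
  then obtain d where d: "c = 5 * d" by blast
  have "\<bar>c\<bar> \<le> 15" "c \<noteq> 0" using \<open>c dvd 15\<close> by (auto simp: zdvd_imp_le)
  then have "d \<in> {-3, -2, -1, 1, 2, 3}" using d by auto
  moreover have "d \<noteq> 2" "d \<noteq> -2" using \<open>c dvd 15\<close> d by auto
  moreover have "d \<noteq> 1" "d \<noteq> -1"
    using eqs(1) three_square_mod_5[OF g, of h t] three_square_mod_5[OF g, of h "-t"] d by auto
  ultimately show ?thesis using d by auto
qed

text \<open>For nonzero \<open>n\<close>, \<open>x = (m/n)^2\<close> makes \<open>x\<close>,
  \<open>x - 5\<close> and \<open>x + 75\<close> squares: a point on the twist by 5 of
  \<open>y^2 = x*(x - 1)*(x + 15)\<close>. Both \<open>m^2 - u^2\<close> and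
  \<open>v^2 - u^2\<close> are 20 times a square, which represents \<open>u\<close> twice. The
  relative sign \<open>r\<close>, the parity of \<open>a'\<close> and the two values of
  \<open>c\<close> make eight branches; seven fail by sign or modulo 8.\<close>

lemma descent_75:
  fixes m n u v :: int
  assumes "coprime m n" "u^2 = m^2 - 5 * n^2" "v^2 = m^2 + 75 * n^2"
  shows "n = 0"
  using assms
proof (induction "nat \<bar>n\<bar>" arbitrary: m n u v rule: less_induct)
  case less
  note cop = less.prems(1) and eq_u = less.prems(2) and eq_v = less.prems(3)
  show "n = 0"
  proof (rule ccontr)
    assume "n \<noteq> 0"
    have m5: "\<not> 5 dvd m"
    proof
      assume "5 dvd m"
      then obtain m' where m': "m = 5 * m'" by blast
      have "u^2 = 5 * (5 * m'^2 - n^2)" unfolding eq_u m' by (simp add: power_mult_distrib)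
      then have "5 dvd u^2" by simp
      then have "5 dvd u" using prime_5_int prime_dvd_power by blast
      then obtain u' where "u = 5 * u'" by blast
      then have "n^2 = 5 * (m'^2 - u'^2)" using eq_u unfolding m' by (simp add: power_mult_distrib)
      then have "5 dvd n^2" by simp
      then have "5 dvd n" using prime_5_int prime_dvd_power by blast
      then have "is_unit (5 :: int)" using cop \<open>5 dvd m\<close> coprime_common_divisor by blast
      then show False by simp
    qed
    \<comment> \<open>For odd \<open>n\<close>, an even \<open>m\<close> makes \<open>u^2\<close>
      congruent to 3 modulo 4; an odd \<open>m\<close> makes \<open>20*n^2\<close> the difference of
      the odd squares \<open>(v/2)^2\<close> and \<open>(u/2)^2\<close>, though 8 does not divide
      it.\<close>
    have "even n"
    proof (rule ccontr)
      assume "odd n"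
      then obtain N where N: "n^2 = 8 * N + 1" by (rule odd_square_8)
      show False
      proof (cases "odd m")
        case True
        then obtain M where M: "m^2 = 8 * M + 1" by (rule odd_square_8)
        have "even (u^2)" "even (v^2)" unfolding eq_u eq_v using True \<open>odd n\<close> by simp_all
        then have "even u" "even v" by simp_all
        then obtain u' v' where uv: "u = 2 * u'" "v = 2 * v'" by blast
        have u': "u'^2 = 2 * M - 10 * N - 1" using eq_u unfolding M N uv by (simp add: power_mult_distrib)
        have v': "v'^2 = 2 * M + 150 * N + 19" using eq_v unfolding M N uv by (simp add: power_mult_distrib)
        have "odd (u'^2)" "odd (v'^2)" unfolding u' v' by simp_all
        then have odds: "odd u'" "odd v'" by simp_all
        obtain U where "u'^2 = 8 * U + 1" using odds(1) by (rule odd_square_8)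
        moreover obtain V where "v'^2 = 8 * V + 1" using odds(2) by (rule odd_square_8)
        ultimately have "8 * (V - U - 20 * N) = 20" using u' v' by simp
        then have "(8 :: int) dvd 20" by (metis dvd_triv_left)
        then show False by simp
      next
        case False
        then obtain m' where "m = 2 * m'" by blast
        then have u: "u^2 = 4 * m'^2 - 40 * N - 5" using eq_u N by (simp add: power_mult_distrib)
        then have "odd (u^2)" by simp
        then have "odd u" by simp
        then obtain U where "u^2 = 8 * U + 1" by (rule odd_square_8)
        then have "4 * (m'^2 - 10 * N - 2 * U) = 6" using u by simp
        then have "(4 :: int) dvd 6" by (metis dvd_triv_left)
        then show False by simp
      qed
    qed
    then obtain k where k: "n = 2 * k" by blast
    have "odd m" using cop \<open>even n\<close> by (meson coprime_common_divisor odd_one)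
    then have "odd (u^2)" unfolding eq_u using \<open>even n\<close> by simp
    then have "odd u" by simp
    have "coprime m 5" using m5 prime_5_int prime_imp_coprime coprime_commute by blast
    then have "coprime (u^2) (m * n)"
      using coprime_square_add[OF cop, of "-5"] eq_u by simp
    then have "coprime u k" unfolding k by simp
    have u5: "\<not> 5 dvd u"
    proof
      assume "5 dvd u"
      then have "5 dvd u^2 + 5 * n^2" by (simp add: power2_eq_square)
      then have "5 dvd m^2" using eq_u by simp
      then show False using m5 prime_5_int prime_dvd_power by blast
    qed
    have "m^2 = u^2 + 20 * k^2" using eq_u unfolding k by (simp add: power_mult_distrib)
    from this \<open>odd u\<close> u5 \<open>coprime u k\<close> obtain a b s
      where ab: "k = a * b" "u = s * (a^2 - 5 * b^2)" "s = 1 \<or> s = -1" "coprime a b"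
      by (rule difference_20_squares)
    have "v^2 = u^2 + 20 * (4 * k)^2" using eq_u eq_v unfolding k by (simp add: power_mult_distrib)
    moreover have "coprime u (4 * k)"
      using \<open>coprime u k\<close> \<open>odd u\<close> coprime_right_4_iff_odd[of u] by simp
    ultimately obtain a' b' t
      where ab': "4 * k = a' * b'" "u = t * (a'^2 - 5 * b'^2)" "t = 1 \<or> t = -1" "coprime a' b'"
      using \<open>odd u\<close> u5 difference_20_squares[of v u "4 * k"] by metis
    have ne: "a \<noteq> 0" "a' \<noteq> 0" using \<open>n \<noteq> 0\<close> ab(1) ab'(1) k by auto
    have a5: "\<not> 5 dvd a"
    proof
      assume "5 dvd a"
      then have "5 dvd a^2 - 5 * b^2" by (simp add: power2_eq_square)
      then show False using u5 unfolding ab(2) by simp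
    qed
    define r where "r = s * t"
    have r: "r = 1 \<or> r = -1" using ab(3) ab'(3) unfolding r_def by auto
    have rel: "a^2 - 5 * b^2 = r * (a'^2 - 5 * b'^2)"
      using ab(2,3) ab'(2,3) unfolding r_def by auto
    have "odd (a' - b')" using \<open>odd u\<close> ab'(2) by simp
    then consider (I) "odd a'" "even b'" | (II) "even a'" "odd b'" by auto
    then show False
    proof cases
      case I
      then have "coprime a' 4" using coprime_right_4_iff_odd by blast
      moreover have "4 dvd a' * b'" using ab'(1) by (metis dvd_triv_left)
      ultimately have "4 dvd b'" by (simp add: coprime_dvd_mult_right_iff coprime_commute)
      then obtain y where y: "b' = 4 * y" by blast
      have "a * b = a' * y" using ab(1) ab'(1) y by simp
      then obtain g h i j where ghij: "a = g * h" "b = i * j" "a' = g * i" "y = h * j" "coprime h i"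
        using ne by (rule four_number)
      have gh5: "\<not> 5 dvd g" "\<not> 5 dvd h" using a5 unfolding ghij by auto
      have odds: "odd g" "odd i" using I unfolding ghij by auto
      have "coprime g j" "coprime h j" using ab(4) unfolding ghij by simp_all
      show False using r
      proof
        assume "r = 1"
        then have "g^2 * (h^2 - i^2) = j^2 * (5 * (i^2 - 16 * h^2))"
          using rel unfolding y ghij by (simp add: power2_eq_square algebra_simps)
        from this \<open>coprime g j\<close> gh5(1) obtain c where c: "h^2 - i^2 = 5 * c * j^2" "i^2 - 16 * h^2 = c * g^2"
          by (rule square_ratio_5)
        have eqs: "15 * h^2 = - c * (g^2 + 5 * j^2)" "15 * i^2 = - c * (g^2 + 80 * j^2)"
          using c by (simp_all add: algebra_simps)
        have "- c = 15 \<or> - c = -15" using eqs ghij(5) gh5(1) by (rule ratio_15)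
        then show False
        proof
          assume "- c = 15"
          \<comment> \<open>The surviving branch: \<open>h\<close>, \<open>j\<close>,
            \<open>g\<close>, \<open>i\<close> solve the original system, and
            \<open>n = 2*g*h*i*j\<close>.\<close>
          then have "g^2 = h^2 - 5 * j^2" "i^2 = h^2 + 75 * j^2" using eqs by simp_all
          moreover have "nat \<bar>j\<bar> < nat \<bar>n\<bar>"
            using abs_less_abs_double_mult[of g "h * i" j] \<open>n \<noteq> 0\<close> unfolding k ab(1) ghij
            by (simp add: mult_ac)
          ultimately have "j = 0" using less.hyps \<open>coprime h j\<close> by blast
          then show False using \<open>n \<noteq> 0\<close> unfolding k ab(1) ghij by simp
        next
          assume "- c = -15"
          then have "h^2 = - (g^2) - 5 * j^2" using eqs(1) by simp
          moreover have "h^2 > 0" using gh5 by auto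
          ultimately show False using zero_le_power2[of g] zero_le_power2[of j] by linarith
        qed
      next
        assume "r = -1"
        then have "g^2 * (h^2 + i^2) = j^2 * (5 * (i^2 + 16 * h^2))"
          using rel unfolding y ghij by (simp add: power2_eq_square algebra_simps)
        from this \<open>coprime g j\<close> gh5(1) obtain c where c: "h^2 + i^2 = 5 * c * j^2" "i^2 + 16 * h^2 = c * g^2"
          by (rule square_ratio_5)
        have eqs: "15 * h^2 = c * (g^2 + 5 * (- (j^2)))" "15 * i^2 = c * (80 * j^2 - g^2)"
          using c by (simp_all add: algebra_simps)
        have "c = 15 \<or> c = -15" using eqs ghij(5) gh5(1) by (rule ratio_15)
        then show False
        proof
          assume "c = 15"
          then have gi: "g^2 + i^2 = 80 * j^2" using eqs by simp
          obtain G where "g^2 = 8 * G + 1" using odds(1) by (rule odd_square_8)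
          moreover obtain I where "i^2 = 8 * I + 1" using odds(2) by (rule odd_square_8)
          ultimately have "8 * (10 * j^2 - G - I) = 2" using gi by simp
          then have "(8 :: int) dvd 2" by (metis dvd_triv_left)
          then show False by simp
        next
          assume "c = -15"
          then have "h^2 + i^2 = - 75 * j^2" using c(1) by simp
          moreover have "h^2 > 0" using gh5 by auto
          ultimately show False using zero_le_power2[of i] zero_le_power2[of j] by linarith
        qed
      qed
    next
      case II
      then have "coprime b' 4" using coprime_right_4_iff_odd by blast
      moreover have "4 dvd b' * a'" using ab'(1) by (metis dvd_triv_left mult.commute)
      ultimately have "4 dvd a'" by (simp add: coprime_dvd_mult_right_iff coprime_commute)
      then obtain x where x: "a' = 4 * x" by blast
      have "a * b = x * b'" "x \<noteq> 0" using ab(1) ab'(1) ne(2) x by simp_all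
      with ne(1) obtain g h i j where ghij: "a = g * h" "b = i * j" "x = g * i" "b' = h * j" "coprime h i"
        using four_number[of a b x b'] by metis
      have gh5: "\<not> 5 dvd g" "\<not> 5 dvd h" using a5 unfolding ghij by auto
      have "coprime g j" "coprime i h" using ab(4) ghij(5) unfolding ghij(1,2) by (simp_all add: coprime_commute)
      have odds: "odd h" "odd j" using II unfolding ghij by auto
      obtain H where H: "h^2 = 8 * H + 1" using odds(1) by (rule odd_square_8)
      obtain J where J: "j^2 = 8 * J + 1" using odds(2) by (rule odd_square_8)
      show False using r
      proof
        assume "r = 1"
        then have "g^2 * (h^2 - 16 * i^2) = j^2 * (5 * (i^2 - h^2))"
          using rel unfolding x ghij by (simp add: power2_eq_square algebra_simps)
        from this \<open>coprime g j\<close> gh5(1) obtain c where c: "h^2 - 16 * i^2 = 5 * c * j^2" "i^2 - h^2 = c * g^2"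
          by (rule square_ratio_5)
        have eqs: "15 * i^2 = - c * (g^2 + 5 * j^2)" "15 * h^2 = - c * (16 * g^2 + 5 * j^2)"
          using c by (simp_all add: algebra_simps)
        have "- c = 15 \<or> - c = -15" using eqs \<open>coprime i h\<close> gh5(1) by (rule ratio_15)
        then have "15 * h^2 = 15 * (16 * g^2 + 5 * j^2) \<or> 15 * h^2 = - 15 * (16 * g^2 + 5 * j^2)"
          using eqs(2) by metis
        then have "8 * (H - 2 * g^2 - 5 * J) = 4 \<or> 8 * (H + 2 * g^2 + 5 * J) = - 6" unfolding H J by auto
        then have "(8 :: int) dvd 4 \<or> (8 :: int) dvd - 6" by (metis dvd_triv_left)
        then show False by simp
      next
        assume "r = -1"
        then have "g^2 * (h^2 + 16 * i^2) = j^2 * (5 * (i^2 + h^2))"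
          using rel unfolding x ghij by (simp add: power2_eq_square algebra_simps)
        from this \<open>coprime g j\<close> gh5(1) obtain c where c: "h^2 + 16 * i^2 = 5 * c * j^2" "i^2 + h^2 = c * g^2"
          by (rule square_ratio_5)
        have eqs: "15 * i^2 = - c * (g^2 + 5 * (- (j^2)))" "15 * h^2 = - c * (5 * j^2 - 16 * g^2)"
          using c by (simp_all add: algebra_simps)
        have "- c = 15 \<or> - c = -15" using eqs \<open>coprime i h\<close> gh5(1) by (rule ratio_15)
        then have "15 * h^2 = 15 * (5 * j^2 - 16 * g^2) \<or> 15 * h^2 = - 15 * (5 * j^2 - 16 * g^2)"
          using eqs(2) by metis
        then have "8 * (H + 2 * g^2 - 5 * J) = 4 \<or> 8 * (H - 2 * g^2 + 5 * J) = - 6" unfolding H J by auto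
        then have "(8 :: int) dvd 4 \<or> (8 :: int) dvd - 6" by (metis dvd_triv_left)
        then show False by simp
      qed
    qed
  qed
qed

section \<open>Splitting a square into coprime factors\<close>

lemma square_factor_square:
  fixes t x w :: int
  assumes "t^2 * x = w^2" "t \<noteq> 0"
  obtains y where "x = y^2"
proof -
  have "t^2 dvd w^2" using assms(1) by (metis dvd_triv_left)
  then have "t dvd w" by simp
  then obtain y where "w = t * y" by blast
  then have "t^2 * x = t^2 * y^2" using assms(1) by (simp add: power_mult_distrib)
  then show ?thesis using that[of y] assms(2) by simp
qed

text \<open>A common divisor of \<open>A\<close> and \<open>B\<close> divides \<open>K*m^k\<close>
  and \<open>K*n^l\<close>; being coprime to \<open>K\<close>, it divides the coprime powers
  themselves. Two explicit identities thus do the work of a resultant.\<close>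

lemma coprime_bezout_powers:
  fixes A B K m n x y x' y' :: int
  assumes "x * A + y * B = K * m^k" "x' * A + y' * B = K * n^l"
    and cop: "coprime m n" and AK: "coprime A K"
  shows "coprime A B"
proof (rule coprimeI)
  fix d assume d: "d dvd A" "d dvd B"
  have "d dvd K * m^k" "d dvd K * n^l" using d unfolding assms(1,2)[symmetric] by simp_all
  moreover have "coprime d K" using AK d(1) by (meson coprime_divisors dvd_refl)
  ultimately have "d dvd m^k" "d dvd n^l" by (simp_all add: coprime_dvd_mult_right_iff)
  moreover have "coprime (m^k) (n^l)" using cop by simp
  ultimately show "is_unit d" using coprime_common_divisor[of "m^k" "n^l" d] by simp
qed

lemma coprime_2_5_powers:
  fixes A :: int
  assumes "odd A" "\<not> 5 dvd A"
  shows "coprime A (2^k * 5^l)"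
proof -
  have "coprime A 5" using assms(2) prime_5_int prime_imp_coprime coprime_commute by blast
  then show ?thesis using assms(1) by simp
qed

text \<open>For odd \<open>m\<close> and \<open>n\<close> a factor 4 is removed from both terms. The
  rest is coprime, since \<open>75*(m^2 - 5*n^2) + 5*(m^2 + 75*n^2) = 80*m^2\<close> and the terms
  differ by \<open>80*n^2\<close>. Each is then a square and \<open>descent_75\<close>
  applies.\<close>

lemma product_75_square:
  fixes m n w :: int
  assumes cop: "coprime m n" and m: "\<not> 5 dvd m"
    and eq: "(m^2 - 5 * n^2) * (m^2 + 75 * n^2) = w^2"
  shows "n = 0"
proof -
  have "\<exists>s P Q. (s = 1 \<or> s = 2) \<and> m^2 - 5 * n^2 = s^2 * P \<and> m^2 + 75 * n^2 = s^2 * Q \<and> odd P"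
  proof (cases "odd m \<and> odd n")
    case True
    obtain M where M: "m^2 = 8 * M + 1" using conjunct1[OF True] by (rule odd_square_8)
    obtain N where N: "n^2 = 8 * N + 1" using conjunct2[OF True] by (rule odd_square_8)
    show ?thesis
      unfolding M N by (rule exI[of _ 2], rule exI[of _ "2 * M - 10 * N - 1"],
        rule exI[of _ "2 * M + 150 * N + 19"]) simp
  next
    case False
    have "\<not> (even m \<and> even n)" using cop by (meson coprime_common_divisor odd_one)
    then have "odd (m^2 - 5 * n^2)" using False by auto
    then show ?thesis
      by (intro exI[of _ 1] exI[of _ "m^2 - 5 * n^2"] exI[of _ "m^2 + 75 * n^2"]) simp
  qed
  then obtain s P Q where s: "s = 1 \<or> s = 2"
    and PQ: "m^2 - 5 * n^2 = s^2 * P" "m^2 + 75 * n^2 = s^2 * Q" "odd P" by blast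
  have "s \<noteq> 0" using s by auto
  have "(s^2)^2 * (P * Q) = w^2" using eq unfolding PQ by (simp add: power2_eq_square mult_ac)
  then obtain W where W: "P * Q = W^2" using \<open>s \<noteq> 0\<close> square_factor_square[of "s^2" "P * Q" w] by auto
  have "\<not> 5 dvd P"
  proof
    assume "5 dvd P"
    then have "5 dvd m^2 - 5 * n^2" unfolding PQ by simp
    then have "5 dvd m^2" by presburger
    then show False using m prime_5_int prime_dvd_power by blast
  qed
  then have "coprime P (2^4 * 5^1)" using PQ(3) coprime_2_5_powers by blast
  then have "coprime P Q"
    by (rule coprime_bezout_powers[where m = m and n = n and k = 2 and l = 2 and x = "75 * s^2" and y = "5 * s^2"
          and x' = "- (s^2)" and y' = "s^2", OF _ _ cop, rotated -1])
      (use PQ(1,2) in \<open>simp_all add: algebra_simps\<close>)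
  have "s^2 * Q \<ge> 0" unfolding PQ(2)[symmetric] by simp
  then have "Q \<ge> 0" using \<open>s \<noteq> 0\<close> by (simp add: zero_le_mult_iff)
  moreover have "P \<ge> 0"
  proof (cases "Q = 0")
    case True
    then have "m^2 + 75 * n^2 = 0" using PQ(2) by simp
    then have "m^2 = 0" using zero_le_power2[of m] zero_le_power2[of n] by linarith
    then show ?thesis using m by simp
  next
    case False
    have "P * Q \<ge> 0" unfolding W by simp
    then show ?thesis using False \<open>Q \<ge> 0\<close> by (simp add: zero_le_mult_iff)
  qed
  ultimately obtain u v where uv: "P = u^2" "Q = v^2"
    using coprime_mult_eq_square[OF \<open>coprime P Q\<close> W] by metis
  show ?thesis
    using descent_75[OF cop, of "s * u" "s * v"] PQ uv by (simp add: power_mult_distrib)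
qed

section \<open>The two quartics as binary forms\<close>

abbreviation form_15 :: "'a :: comm_ring_1 \<Rightarrow> 'a \<Rightarrow> 'a" where
  "form_15 m n \<equiv> 5 * m^4 + 14 * m^2 * n^2 - 3 * n^4"

abbreviation form_17 :: "'a :: comm_ring_1 \<Rightarrow> 'a \<Rightarrow> 'a" where
  "form_17 m n \<equiv> 5 * m^4 - 8 * m^3 * n + 6 * m^2 * n^2 + 8 * m * n^3 + 5 * n^4"

lemma form_17_sum_squares:
  "form_17 m n = (m^2 - n^2 - 4 * m * n)^2 + (2 * (m^2 - n^2))^2" for m n :: "'a :: comm_ring_1"
  by (simp add: power2_eq_square power3_eq_cube power4_eq_xxxx algebra_simps)

lemma form_15_factor:
  "form_15 m n = (5 * m^2 - n^2) * (m^2 + 3 * n^2)" for m n :: "'a :: comm_ring_1"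
  by (simp add: power2_eq_square power4_eq_xxxx algebra_simps)

text \<open>For odd \<open>m\<close> and \<open>n\<close> both forms are divisible by 16, and
  \<open>form_15\<close> by no higher power of 2; otherwise \<open>form_15\<close> is odd. The
  common factor is thus a square and contributes no square class of 2.\<close>

lemma forms_common_square_factor:
  fixes m n :: int
  assumes cop: "coprime m n"
  obtains t A B where "t \<noteq> 0" "t dvd 4" "form_15 m n = t^2 * A" "form_17 m n = t^2 * B" "odd A"
proof (cases "odd m \<and> odd n")
  case True
  obtain M where M: "m^2 = 8 * M + 1" using conjunct1[OF True] by (rule odd_square_8)
  obtain N where N: "n^2 = 8 * N + 1" using conjunct2[OF True] by (rule odd_square_8)
  have "form_15 m n = 4^2 * ((10 * M - 2 * N + 1) * (2 * M + 6 * N + 1))"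
    unfolding form_15_factor unfolding M N by (simp add: algebra_simps)
  moreover have "form_17 m n = 4^2 * ((2 * (M - N) - m * n)^2 + (4 * (M - N))^2)"
    unfolding form_17_sum_squares unfolding M N by (simp add: power2_eq_square algebra_simps)
  ultimately show ?thesis by (rule that[rotated 2]) simp_all
next
  case False
  have "\<not> (even m \<and> even n)" using cop by (meson coprime_common_divisor odd_one)
  then have "odd (form_15 m n)" using False by auto
  then show ?thesis using that[of 1] by simp
qed

lemma form_17_pos:
  fixes m n :: int
  assumes "n \<noteq> 0"
  shows "form_17 m n > 0"
proof -
  have "m \<noteq> 0" if "m^2 - n^2 = 0" using that assms by auto
  then have "m^2 - n^2 - 4 * m * n \<noteq> 0 \<or> 2 * (m^2 - n^2) \<noteq> 0" using assms by auto
  then show ?thesis unfolding form_17_sum_squares sum_power2_gt_zero_iff .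
qed

text \<open>
  The forms have resultant \<open>\<plusminus>2\<^sup>a 5\<^sup>b\<close>, as witnessed by the explicit Bezout identities below.
  The prime 5 can only be common when \<open>5 | n\<close>, and then \<open>descent_75\<close> applies.
\<close>
lemma forms_product_square:
  fixes m n v :: int
  assumes cop: "coprime m n" and n: "n \<noteq> 0" and eq: "form_15 m n * form_17 m n = v^2"
  obtains w where "form_17 m n = w^2"
proof -
  obtain t A B where t: "t \<noteq> 0" "t dvd 4" and AB: "form_15 m n = t^2 * A" "form_17 m n = t^2 * B" "odd A"
    using cop by (rule forms_common_square_factor)
  have "(t^2)^2 * (A * B) = v^2" using eq unfolding AB by (simp add: power2_eq_square mult_ac)
  then obtain V where V: "A * B = V^2" using t(1) square_factor_square[of "t^2" "A * B" v] by auto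
  have "B > 0"
    using form_17_pos[OF n, of m] t(1) unfolding AB by (simp add: zero_less_mult_iff)
  have "A * B \<ge> 0" unfolding V by simp
  then have "A \<ge> 0" using \<open>B > 0\<close> by (simp add: zero_le_mult_iff)
  show ?thesis
  proof (cases "5 dvd n")
    case False
    have "\<not> 5 dvd A"
    proof
      assume "5 dvd A"
      then have "5 dvd form_15 m n" unfolding AB by simp
      \<comment> \<open>Modulo 5, \<open>form_15\<close> is \<open>-2*n^2*(3*m^2 - n^2)\<close>, and
        3 is a non-residue.\<close>
      moreover have "n^2 * (2 * (3 * m^2 - n^2)) = 5 * (m^4 + 4 * m^2 * n^2 - n^4) - form_15 m n"
        by (simp add: power2_eq_square power4_eq_xxxx algebra_simps)
      ultimately have "5 dvd n^2 * (2 * (3 * m^2 - n^2))" by (metis dvd_diff dvd_triv_left)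
      moreover have "coprime 5 (n^2)" "coprime 5 (2 :: int)"
        using prime_imp_coprime[OF prime_5_int False] by simp_all
      ultimately have "5 dvd 3 * m^2 - n^2" by (metis coprime_dvd_mult_right_iff)
      then obtain j where "3 * m^2 - n^2 = 5 * j" by blast
      then have "3 * m^2 = n^2 + 5 * j" by simp
      then show False using three_square_mod_5(1)[OF False] by blast
    qed
    then have cA: "coprime A (2^8 * 5^1)" using AB(3) coprime_2_5_powers by blast
    \<comment> \<open>The cubic cofactors solve the Sylvester system of the two forms for the pure
      powers \<open>n^7\<close> and \<open>m^7\<close>. The factor 5 here equalises the constants,
      so that one \<open>K\<close> serves both.\<close>
    have e2: "(5 * (- 7 * n^3 + 47 * m * n^2 - 39 * m^2 * n + 15 * m^3)) * form_15 m n
      + (5 * (47 * n^3 - 47 * m * n^2 + 15 * m^2 * n - 15 * m^3)) * form_17 m n = 2^8 * 5^1 * n^7"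
      by (simp add: power_numeral_reduce algebra_simps)
    have e1: "(- 85 * n^3 - 161 * m * n^2 - 117 * m^2 * n + 171 * m^3) * form_15 m n
      + (- 51 * n^3 - 15 * m * n^2 + 253 * m^2 * n + 85 * m^3) * form_17 m n = 2^8 * 5^1 * m^7"
      by (simp add: power_numeral_reduce algebra_simps)
    have "coprime A B"
      by (rule coprime_bezout_powers[OF e1[unfolded AB mult.assoc[symmetric]]
            e2[unfolded AB mult.assoc[symmetric]] cop cA])
    moreover have "B \<ge> 0" using \<open>B > 0\<close> by simp
    ultimately obtain x y where "A = x^2" "B = y^2"
      using V \<open>A \<ge> 0\<close> coprime_mult_eq_square by metis
    then show ?thesis using that[of "t * y"] AB(2) by (simp add: power_mult_distrib)
  next
    case True
    then obtain k where k: "n = 5 * k" by blast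
    have "coprime 5 (4 :: int)" using prime_imp_coprime[OF prime_5_int, of 4] by simp
    then have "coprime 5 t" using t(2) coprime_divisors[of 5 5 t 4] by simp
    then have ct: "coprime 5 (t^2)" by simp
    have m: "\<not> 5 dvd m" using True cop coprime_common_divisor[of m n 5] by auto
    have "5 dvd form_15 m n" "5 dvd form_17 m n" unfolding k by (simp_all add: power_mult_distrib)
    then have "5 dvd A" "5 dvd B" unfolding AB using ct by (simp_all add: coprime_dvd_mult_right_iff)
    then obtain A' B' where AB': "A = 5 * A'" "B = 5 * B'" by blast
    have f: "t^2 * A' = m^4 + 70 * m^2 * k^2 - 375 * k^4"
      "t^2 * B' = m^4 - 8 * m^3 * k + 30 * m^2 * k^2 + 200 * m * k^3 + 625 * k^4"
      using AB(1,2) unfolding AB' k by (simp_all add: power_mult_distrib)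
    have "5^2 * (A' * B') = V^2" using V unfolding AB' by simp
    then obtain V' where V': "A' * B' = V'^2" using square_factor_square[of 5 "A' * B'" V] by auto
    have "\<not> 5 dvd A'"
    proof
      assume "5 dvd A'"
      then have "5 dvd m^4 + 70 * m^2 * k^2 - 375 * k^4" unfolding f[symmetric] by simp
      moreover have "m^4 + 70 * m^2 * k^2 - 375 * k^4 = m^4 + 5 * (14 * m^2 * k^2 - 75 * k^4)" by simp
      ultimately have "5 dvd m^4" by (metis dvd_add_left_iff dvd_triv_left)
      then show False using m prime_5_int prime_dvd_power by blast
    qed
    moreover have "odd A'" using AB(3) AB' by simp
    ultimately have cA: "coprime A' (2^8 * 5^5)" using coprime_2_5_powers by blast
    \<comment> \<open>The earlier identities at \<open>n = 5*k\<close>, rescaled by powers of 5 to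
      the common constant \<open>2^8 * 5^5\<close>.\<close>
    have e2: "(- 175 * k^3 + 235 * m * k^2 - 39 * m^2 * k + 3 * m^3) * (t^2 * A')
      + (1175 * k^3 - 235 * m * k^2 + 15 * m^2 * k - 3 * m^3) * (t^2 * B') = 2^8 * 5^5 * k^7"
      unfolding f by (simp add: power_numeral_reduce algebra_simps)
    have e1: "(5^5 * (- 10625 * k^3 - 4025 * m * k^2 - 585 * m^2 * k + 171 * m^3)) * (t^2 * A')
      + (5^5 * (- 6375 * k^3 - 375 * m * k^2 + 1265 * m^2 * k + 85 * m^3)) * (t^2 * B') = 2^8 * 5^5 * m^7"
      unfolding f by (simp add: power_numeral_reduce algebra_simps)
    have "coprime m k" using cop unfolding k by simp
    then have "coprime A' B'"
      by (rule coprime_bezout_powers[OF e1[unfolded mult.assoc[symmetric]]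
            e2[unfolded mult.assoc[symmetric]] _ cA])
    moreover have "A' \<ge> 0" "B' \<ge> 0" using \<open>A \<ge> 0\<close> \<open>B > 0\<close> AB' by simp_all
    ultimately obtain x y where "A' = x^2" "B' = y^2"
      using V' coprime_mult_eq_square by metis
    then have "(m^2 - 5 * k^2) * (m^2 + 75 * k^2) = (t * x)^2"
      using f(1) by (simp add: power_mult_distrib power2_eq_square power4_eq_xxxx algebra_simps)
    then have "k = 0" using \<open>coprime m k\<close> m product_75_square by blast
    then show ?thesis using n k by simp
  qed
qed

section \<open>Parabolas through conjugate points\<close>

lemma curve_product_rat:
  fixes q v :: rat
  assumes eq: "(5 * q^4 + 14 * q^2 - 3) * (5 * q^4 - 8 * q^3 + 6 * q^2 + 8 * q + 5) = v^2"
  shows "q^2 = 1"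
proof -
  obtain m n where mn: "quotient_of q = (m, n)" by fastforce
  have n: "n > 0" "coprime m n" "q = of_int m / of_int n"
    using quotient_of_denom_pos[OF mn] quotient_of_coprime[OF mn] quotient_of_div[OF mn] by auto
  define N M :: rat where "N = of_int n" and "M = of_int m"
  have "N \<noteq> 0" and M: "M = q * N" using n unfolding N_def M_def by simp_all
  have f15: "of_int (form_15 m n) = (5 * q^4 + 14 * q^2 - 3) * N^4"
    using M unfolding N_def M_def
    by (simp add: power2_eq_square power3_eq_cube power4_eq_xxxx algebra_simps)
  have f17: "of_int (form_17 m n) = (5 * q^4 - 8 * q^3 + 6 * q^2 + 8 * q + 5) * N^4"
    using M unfolding N_def M_def
    by (simp add: power2_eq_square power3_eq_cube power4_eq_xxxx algebra_simps)
  have "(v * N^4)^2 = of_int (form_15 m n) * of_int (form_17 m n)"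
    unfolding f15 f17 power_mult_distrib eq[symmetric] by (simp add: power2_eq_square mult_ac)
  then have "(v * N^4)^2 = of_int (form_15 m n * form_17 m n)" by (simp only: of_int_mult)
  then obtain V where "form_15 m n * form_17 m n = V^2" by (rule rat_square_eq_of_int)
  then obtain w where "form_17 m n = w^2"
    using forms_product_square[of m n V] n by auto
  then have "(of_int w :: rat)^2 = of_int (form_17 m n)" by simp
  then have "(of_int w / N^2)^2 = 5 * q^4 - 8 * q^3 + 6 * q^2 + 8 * q + 5"
    unfolding f17 using \<open>N \<noteq> 0\<close> by (simp add: power_divide flip: power_mult)
  then show ?thesis using curve_17_rat_points by blast
qed

text \<open>
  A point \<open>(q, y)\<close> of \<open>y\<^sup>2 = 5x\<^sup>4 + fx\<^sup>3 + hx\<^sup>2 - fx + 11 - h\<close> with \<open>q\<^sup>2 + Aq + B = 0\<close>,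
  its conjugate and \<open>(1, 4)\<close> lie on a parabola, whose leading coefficient is \<open>c\<close>. The fourth
  intersection point with the curve is rational; the three cases below are the possible positions
  \<open>(-1, 4)\<close>, \<open>(-1, -4)\<close> and \<open>(1, 4)\<close>.
\<close>
lemma conjugate_points_parabola:
  fixes A B a b f h :: rat
  assumes r1: "- f - 2 * a * b - B * (f - 5 * A) - A * (h - b^2 - 5 * B - A * (f - 5 * A)) = 0"
    and r0: "11 - h - a^2 - B * (h - b^2 - 5 * B - A * (f - 5 * A)) = 0"
    and nz: "1 + A + B \<noteq> 0"
    and points: "\<And>x y. y^2 = 5 * x^4 + f * x^3 + h * x^2 - f * x + (11 - h) \<Longrightarrow> x^2 = 1 \<and> y^2 = 16"
  obtains c k where "k = 5 - c^2" "k \<noteq> 0"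
    "k * A = f \<and> k * B = 5 + h - 8 * c + c^2 \<or>
     k * A = f - 8 * c \<and> k * B = c^2 + h - 11 \<or>
     k * A = f - 2 * c * (4 - 2 * c - (6 - f - h) / 4) + 2 * k \<and>
     k * B = 11 - h - (c + (6 - f - h) / 4)^2"
proof -
  define k1 k0 where "k1 = f - 5 * A" and "k0 = h - b^2 - 5 * B - A * k1"
  \<comment> \<open>Adding \<open>c*(x^2 + A*x + B)\<close> to the line \<open>a + b*x\<close> keeps
    its values at the conjugate points; this \<open>c\<close> makes the result pass through
    \<open>(1, 4)\<close>.\<close>
  define c where "c = (4 - a - b) / (1 + A + B)"
  define \<beta> \<gamma> where "\<beta> = b + c * A" and "\<gamma> = a + c * B"
  have c: "c * (1 + A + B) = 4 - a - b" unfolding c_def using nz by simp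
  have sum4: "c + \<beta> + \<gamma> = 4" using c unfolding \<beta>_def \<gamma>_def by (simp add: algebra_simps)
  define k l m where "k = 5 - c^2" and "l = k1 - 2 * c * b - c^2 * A" and "m = k0 - 2 * c * a - c^2 * B"
  have cf3: "k * A + l = f - 2 * c * \<beta>"
    unfolding k_def l_def k1_def \<beta>_def by (simp add: power2_eq_square algebra_simps)
  have cf2: "k * B + A * l + m = h - \<beta>^2 - 2 * c * \<gamma>"
    unfolding k_def l_def m_def k0_def \<beta>_def \<gamma>_def by (simp add: power2_eq_square algebra_simps)
  have cf1: "A * m + B * l = - f - 2 * \<beta> * \<gamma>"
    using r1 unfolding k1_def [symmetric] k0_def [symmetric] l_def m_def \<beta>_def \<gamma>_def by (simp add: power2_eq_square algebra_simps)
  have cf0: "B * m = 11 - h - \<gamma>^2"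
    using r0 unfolding k1_def [symmetric] k0_def [symmetric] m_def \<gamma>_def by (simp add: power2_eq_square algebra_simps)
  have factor: "5 * x^4 + f * x^3 + h * x^2 - f * x + (11 - h) - (c * x^2 + \<beta> * x + \<gamma>)^2
      = (x^2 + A * x + B) * (k * x^2 + l * x + m)" for x
  proof -
    have "(x^2 + A * x + B) * (k * x^2 + l * x + m)
      = k * x^4 + (k * A + l) * x^3 + (k * B + A * l + m) * x^2 + (A * m + B * l) * x + B * m"
      by (simp add: power2_eq_square power3_eq_cube power4_eq_xxxx algebra_simps)
    then show ?thesis
      unfolding cf3 cf2 cf1 cf0 unfolding k_def
      by (simp add: power2_eq_square power3_eq_cube power4_eq_xxxx algebra_simps)
  qed
  have "(1 + A + B) * (k + l + m) = 0" using factor[of 1] sum4 by (simp add: add_ac)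
  then have klm: "k + l + m = 0" using nz by simp
  \<comment> \<open>As 5 is not a rational square, the residual factor is a genuine quadratic. One
    root is 1, so the other is \<open>m/k\<close>.\<close>
  have "k \<noteq> 0" using rat_square_mod_3[of 5 c] unfolding k_def by auto
  define x where "x = m / k"
  have m: "m = k * x" unfolding x_def using \<open>k \<noteq> 0\<close> by simp
  then have l: "l = - k - k * x" using klm by simp
  have "k * x^2 + l * x + m = 0" unfolding l m by (simp add: power2_eq_square algebra_simps)
  then have pt: "(c * x^2 + \<beta> * x + \<gamma>)^2 = 5 * x^4 + f * x^3 + h * x^2 - f * x + (11 - h)"
    using factor[of x] by simp
  from points[OF this] have x2: "x^2 = 1" and y2: "(c * x^2 + \<beta> * x + \<gamma>)^2 = 16" by auto
  have "x = 1 \<or> x = -1" using x2 by (simp add: power2_eq_1_iff)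
  then show ?thesis
  proof
    assume "x = 1"
    then have ml: "m = k" "l = - 2 * k" using m l by simp_all
    have kA: "k * A = f - 2 * c * \<beta> + 2 * k" and kB: "k * B = 11 - h - \<gamma>^2"
      using cf3 cf0 unfolding ml by (simp_all add: algebra_simps)
    have "k * A - 2 * (k * B) = - f - 2 * \<beta> * \<gamma>"
      using cf1 unfolding ml by (simp add: algebra_simps)
    \<comment> \<open>The fourth point coincides with \<open>(1, 4)\<close>. Substituting
      \<open>\<beta> = 4 - c - \<gamma>\<close> cancels all products with \<open>\<gamma>\<close>,
      leaving a linear equation that determines it from \<open>c\<close>.\<close>
    then have "2 * f - 2 * c * \<beta> + 2 * k - 22 + 2 * h + 2 * \<gamma> * (\<beta> + \<gamma>) = 0"
      unfolding kA kB by (simp add: power2_eq_square algebra_simps)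
    moreover have \<beta>: "\<beta> = 4 - c - \<gamma>" using sum4 by simp
    ultimately have "8 * \<gamma> = 8 * c + 2 * (6 - f - h)"
      unfolding k_def by (simp add: power2_eq_square algebra_simps)
    then have \<gamma>: "\<gamma> = c + (6 - f - h) / 4" by (simp add: field_simps)
    have \<beta>': "\<beta> = 4 - 2 * c - (6 - f - h) / 4" unfolding \<beta> \<gamma> by simp
    show ?thesis using that[of k c] kA kB \<open>k \<noteq> 0\<close> k_def unfolding \<gamma> \<beta>' by blast
  next
    assume "x = -1"
    then have ml: "m = - k" "l = 0" using m l by simp_all
    have kA: "k * A = f - 2 * c * \<beta>" and kB: "k * B = \<gamma>^2 + h - 11"
      using cf3 cf0 unfolding ml by (simp_all add: algebra_simps)
    have "(c - \<beta> + \<gamma>)^2 = 4^2" using y2 \<open>x = -1\<close> by simp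
    then have "c - \<beta> + \<gamma> = 4 \<or> c - \<beta> + \<gamma> = -4" unfolding power2_eq_iff .
    then show ?thesis
    proof
      assume "c - \<beta> + \<gamma> = 4"
      then have "\<beta> = 0" and \<gamma>: "\<gamma> = 4 - c" using sum4 by simp_all
      then have "k * A = f" using kA by simp
      moreover have "k * B = 5 + h - 8 * c + c^2"
        unfolding kB \<gamma> by (simp add: power2_eq_square algebra_simps)
      ultimately show ?thesis using that[of k c] \<open>k \<noteq> 0\<close> k_def by blast
    next
      assume "c - \<beta> + \<gamma> = -4"
      then have "\<beta> = 4" "\<gamma> = - c" using sum4 by simp_all
      then have "k * A = f - 8 * c" "k * B = c^2 + h - 11"
        using kA kB by (simp_all add: power2_eq_square algebra_simps)
      then show ?thesis using that[of k c] \<open>k \<noteq> 0\<close> k_def by blast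
    qed
  qed
qed

text \<open>The case \<open>f = 0\<close>, \<open>h = 14\<close>, with terms such as
  \<open>- 0\<close> kept to match the general relations literally. The position
  \<open>(-1, 4)\<close> gives the line; the other two parametrise the same conic by
  \<open>c\<close>.\<close>

lemma curve_15_conjugate_points:
  fixes A B a b :: rat
  assumes rels: "- 0 - 2 * a * b - B * (0 - 5 * A) - A * (14 - b^2 - 5 * B - A * (0 - 5 * A)) = 0"
    "11 - 14 - a^2 - B * (14 - b^2 - 5 * B - A * (0 - 5 * A)) = 0" "1 + A + B \<noteq> 0"
  shows "A = 0 \<or> A^2 = (1 + B) * (5 * B - 3)"
proof -
  have points: "y^2 = 5 * x^4 + 0 * x^3 + 14 * x^2 - 0 * x + (11 - 14) \<Longrightarrow> x^2 = 1 \<and> y^2 = 16" for x y :: rat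
    using curve_15_rat_points[of y x] by simp
  obtain c k where k: "k = 5 - c^2" "k \<noteq> 0" and
    "k * A = 0 \<and> k * B = 5 + 14 - 8 * c + c^2 \<or>
     k * A = 0 - 8 * c \<and> k * B = c^2 + 14 - 11 \<or>
     k * A = 0 - 2 * c * (4 - 2 * c - (6 - 0 - 14) / 4) + 2 * k \<and>
     k * B = 11 - 14 - (c + (6 - 0 - 14) / 4)^2"
    using conjugate_points_parabola[OF rels points] by blast
  then consider "k * A = 0" | "k * A = - 8 * c" "k * B = c^2 + 3"
    | "k * A = - 2 * c * (6 - 2 * c) + 2 * k" "k * B = - 3 - (c - 2)^2" by auto
  then show ?thesis
  proof cases
    case 1
    then show ?thesis using k(2) by simp
  next
    case 2
    have "(k * A)^2 = (k + k * B) * (5 * (k * B) - 3 * k)"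
      unfolding 2 unfolding k(1) by (simp add: power2_eq_square algebra_simps)
    then have "k^2 * A^2 = k^2 * ((1 + B) * (5 * B - 3))" by (simp add: power2_eq_square algebra_simps)
    then show ?thesis using k(2) by simp
  next
    case 3
    have "(k * A)^2 = (k + k * B) * (5 * (k * B) - 3 * k)"
      unfolding 3 unfolding k(1) by (simp add: power2_eq_square algebra_simps)
    then have "k^2 * A^2 = k^2 * ((1 + B) * (5 * B - 3))" by (simp add: power2_eq_square algebra_simps)
    then show ?thesis using k(2) by simp
  qed
qed

lemma curve_17_conjugate_points:
  fixes A B a b :: rat
  assumes rels: "- (- 8) - 2 * a * b - B * (- 8 - 5 * A) - A * (6 - b^2 - 5 * B - A * (- 8 - 5 * A)) = 0"
    "11 - 6 - a^2 - B * (6 - b^2 - 5 * B - A * (- 8 - 5 * A)) = 0" "1 + A + B \<noteq> 0"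
  shows "B = -1 \<or> A^2 = 4 * A * (B - 1) + (1 + B)^2"
proof -
  have points: "y^2 = 5 * x^4 + (- 8) * x^3 + 6 * x^2 - (- 8) * x + (11 - 6) \<Longrightarrow> x^2 = 1 \<and> y^2 = 16" for x y :: rat
    using curve_17_rat_points[of y x] by simp
  obtain c k where k: "k = 5 - c^2" "k \<noteq> 0" and
    "k * A = - 8 \<and> k * B = 5 + 6 - 8 * c + c^2 \<or>
     k * A = - 8 - 8 * c \<and> k * B = c^2 + 6 - 11 \<or>
     k * A = - 8 - 2 * c * (4 - 2 * c - (6 - (- 8) - 6) / 4) + 2 * k \<and>
     k * B = 11 - 6 - (c + (6 - (- 8) - 6) / 4)^2"
    using conjugate_points_parabola[OF rels points] by blast
  then consider "k * A = - 8" "k * B = 11 - 8 * c + c^2" | "k * B = - 1 * k"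
    | "k * A = - 8 - 2 * c * (2 - 2 * c) + 2 * k" "k * B = 5 - (c + 2)^2" by auto
  then show ?thesis
  proof cases
    case 1
    have "(k * A)^2 = 4 * (k * A) * (k * B - k) + (k + k * B)^2"
      unfolding 1 unfolding k(1) by (simp add: power2_eq_square algebra_simps)
    then have "k^2 * A^2 = k^2 * (4 * A * (B - 1) + (1 + B)^2)" by (simp add: power2_eq_square algebra_simps)
    then show ?thesis using k(2) by simp
  next
    case 2
    then have "k * (B + 1) = 0" by (simp add: algebra_simps)
    then show ?thesis using k(2) by (simp add: add_eq_0_iff2)
  next
    case 3
    have "(k * A)^2 = 4 * (k * A) * (k * B - k) + (k + k * B)^2"
      unfolding 3 unfolding k(1) by (simp add: power2_eq_square algebra_simps)
    then have "k^2 * A^2 = k^2 * (4 * A * (B - 1) + (1 + B)^2)" by (simp add: power2_eq_square algebra_simps)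
    then show ?thesis using k(2) by simp
  qed
qed

text \<open>The equations of the two conics differ by \<open>4*(B - 1)*(1 + B - A)\<close>, so their
  common points lie on a pair of lines.\<close>

lemma conics_intersection:
  fixes A B :: rat
  assumes "A = 0 \<or> A^2 = (1 + B) * (5 * B - 3)" "B = -1 \<or> A^2 = 4 * A * (B - 1) + (1 + B)^2"
  shows "A = 0 \<and> B = -1 \<or> B = 1 \<and> A^2 = 4 \<or> A = 1 + B"
proof (cases "A = 0 \<or> B = -1")
  case True
  then show ?thesis using assms by auto
next
  case False
  then have "(1 + B) * (5 * B - 3) = 4 * A * (B - 1) + (1 + B)^2" "A^2 = (1 + B) * (5 * B - 3)"
    using assms by auto
  moreover from this(1) have "(B - 1) * (1 + B - A) = 0" by (simp add: power2_eq_square algebra_simps)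
  ultimately show ?thesis by auto
qed

section \<open>Points over fields of degree at most two\<close>

lemma rat_of_irrational_relation:
  fixes q :: complex and r s :: rat
  assumes "q \<notin> \<rat>" "of_rat r * q + of_rat s = 0"
  shows "r = 0" "s = 0"
proof -
  show "r = 0"
  proof (rule ccontr)
    assume "r \<noteq> 0"
    then have "q = of_rat (- s / r)"
      using assms(2) by (simp add: of_rat_divide of_rat_minus field_simps add_eq_0_iff)
    then show False using assms(1) by simp
  qed
  then show "s = 0" using assms(2) by simp
qed

text \<open>The quartic minus \<open>(a + b*x)^2\<close> leaves a rational linear remainder modulo
  \<open>x^2 + A*x + B\<close>. It vanishes at the irrational \<open>q\<close>, so both of its
  coefficients are zero.\<close>

lemma irrational_point_relations:
  fixes q y :: complex and A B a b f h :: rat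
  assumes q: "q \<notin> \<rat>" "q^2 = - of_rat A * q - of_rat B"
    and y: "y = of_rat a + of_rat b * q"
    and eq: "y^2 = 5 * q^4 + of_rat f * q^3 + of_rat h * q^2 - of_rat f * q + (11 - of_rat h)"
  shows "- f - 2 * a * b - B * (f - 5 * A) - A * (h - b^2 - 5 * B - A * (f - 5 * A)) = 0"
    and "11 - h - a^2 - B * (h - b^2 - 5 * B - A * (f - 5 * A)) = 0"
proof -
  define A' B' a' b' f' h' :: complex where
    defs: "A' = of_rat A" "B' = of_rat B" "a' = of_rat a" "b' = of_rat b" "f' = of_rat f" "h' = of_rat h"
  define r1 where "r1 = - f - 2 * a * b - B * (f - 5 * A) - A * (h - b^2 - 5 * B - A * (f - 5 * A))"
  define r0 where "r0 = 11 - h - a^2 - B * (h - b^2 - 5 * B - A * (f - 5 * A))"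
  have q2: "q^2 + A' * q + B' = 0" using q(2) unfolding defs by simp
  have "0 = 5 * q^4 + f' * q^3 + h' * q^2 - f' * q + (11 - h') - (a' + b' * q)^2"
    using eq unfolding y defs by simp
  also have "\<dots> = (q^2 + A' * q + B') * (5 * q^2 + (f' - 5 * A') * q + (h' - b'^2 - 5 * B' - A' * (f' - 5 * A')))
     + (of_rat r1 * q + of_rat r0)"
    unfolding r1_def r0_def defs
    by (simp add: of_rat_add of_rat_diff of_rat_minus of_rat_mult of_rat_power
        power2_eq_square power3_eq_cube power4_eq_xxxx algebra_simps)
  finally have "of_rat r1 * q + of_rat r0 = 0" unfolding q2 by simp
  from rat_of_irrational_relation[OF q(1) this]
  show "- f - 2 * a * b - B * (f - 5 * A) - A * (h - b^2 - 5 * B - A * (f - 5 * A)) = 0"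
    "11 - h - a^2 - B * (h - b^2 - 5 * B - A * (f - 5 * A)) = 0"
    unfolding r1_def r0_def by auto
qed

section \<open>The complex numbers as an algebraic structure, and subfields of small degree\<close>

interpretation CC: ring complex_field
  by (rule ring_from_type_algebra)

lemma complex_field_simps [simp]:
  "carrier complex_field = UNIV" "\<zero>\<^bsub>complex_field\<^esub> = 0" "\<one>\<^bsub>complex_field\<^esub> = 1"
  "x \<oplus>\<^bsub>complex_field\<^esub> y = x + y" "x \<otimes>\<^bsub>complex_field\<^esub> y = x * y"
  by (simp_all add: ring_of_type_algebra_def)

lemma complex_field_minus [simp]: "\<ominus>\<^bsub>complex_field\<^esub> x = - x"
  using CC.minus_equality[of "- x" x] by simp

lemma complex_field_inv [simp]: "x \<noteq> 0 \<Longrightarrow> inv\<^bsub>complex_field\<^esub> x = inverse x"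
  using CC.inv_unique'[of x "inverse x"] by simp

lemma subfield_Rats: "subfield \<rat> complex_field"
  by (rule field.subfieldI'[OF field_from_type_algebra CC.subringI]) auto

lemma generate_field_Rats:
  assumes "S \<subseteq> \<rat>"
  shows "generate_field complex_field S = \<rat>"
proof
  show "generate_field complex_field S \<subseteq> \<rat>"
    by (rule field.generate_field_min_subfield1[OF field_from_type_algebra _ subfield_Rats assms]) simp
  have zero: "0 \<in> generate_field complex_field S"
    using field.zero_in_generate[OF field_from_type_algebra, of S] by simp
  have nat: "of_nat n \<in> generate_field complex_field S" for n
  proof (induction n)
    case (Suc n)
    then show ?case
      using generate_field.eng_add[OF Suc generate_field.one] by (simp add: add.commute)
  qed (use zero in simp)
  have int: "of_int k \<in> generate_field complex_field S" for k
    using nat[of "nat k"] generate_field.a_inv[OF nat[of "nat (- k)"]]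
    by (cases "k \<ge> 0") simp_all
  show "\<rat> \<subseteq> generate_field complex_field S"
  proof
    fix x :: complex assume "x \<in> \<rat>"
    then obtain a b where x: "x = of_int a / of_int b" "b \<noteq> 0"
      by (metis Rats_cases' less_irrefl)
    then have "inverse (of_int b) \<in> generate_field complex_field S"
      using generate_field.m_inv[OF int[of b]] by simp
    then show "x \<in> generate_field complex_field S"
      using generate_field.eng_mult[OF int[of a]] x(1) by (simp add: divide_inverse)
  qed
qed

text \<open>Peels off one line extension at a time. Dimensions 0 and 1 are padded with the generator
  0, so that one statement covers every degree up to two.\<close>

lemma degree_over_Q_le_2_spanned:
  assumes "degree_over_Q_le K 2"
  obtains v w where "\<And>x. x \<in> K \<Longrightarrow> \<exists>a b. x = of_rat a * v + of_rat b * w"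
proof -
  obtain n where n: "n \<le> 2" "CC.dimension n \<rat> K"
    using assms unfolding degree_over_Q_le_def by blast
  have dim0: "E = {0}" if "CC.dimension 0 \<rat> E" for E
    using that by (cases rule: CC.dimension.cases) simp_all
  have step: "\<exists>v F. CC.dimension n \<rat> F \<and> (\<forall>x\<in>E. \<exists>a. \<exists>u\<in>F. x = of_rat a * v + u)"
    if "CC.dimension (Suc n) \<rat> E" for E n
    using that
  proof (cases rule: CC.dimension.cases)
    case (Suc_dim v F)
    have "\<exists>a. \<exists>u\<in>F. x = of_rat a * v + u" if "x \<in> E" for x
      using that unfolding Suc_dim(1) CC.line_extension_mem_iff complex_field_simps
      by (metis Rats_cases)
    then show ?thesis using Suc_dim by blast
  qed
  consider "n = 0" | "n = Suc 0" | "n = Suc (Suc 0)" using n(1) by linarith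
  then show ?thesis
  proof cases
    case 1
    then have "K = {0}" using dim0 n(2) by simp
    then show ?thesis using that[of 0 0] by simp
  next
    case 2
    then obtain v F where "CC.dimension 0 \<rat> F" and v: "\<forall>x\<in>K. \<exists>a. \<exists>u\<in>F. x = of_rat a * v + u"
      using step n(2) by blast
    then have "F = {0}" using dim0 by blast
    then show ?thesis using that[of v 0] v by simp
  next
    case 3
    then obtain v F where F: "CC.dimension (Suc 0) \<rat> F" and v: "\<forall>x\<in>K. \<exists>a. \<exists>u\<in>F. x = of_rat a * v + u"
      using step n(2) by blast
    then obtain w G where "CC.dimension 0 \<rat> G" and w: "\<forall>x\<in>F. \<exists>a. \<exists>u\<in>G. x = of_rat a * w + u"
      using step by blast
    then have "G = {0}" using dim0 by blast
    then show ?thesis using that[of v w] v w by fastforce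
  qed
qed

text \<open>Cramer's rule: \<open>D\<close> is the determinant expressing 1 and \<open>q\<close> by
  \<open>v\<close> and \<open>w\<close>, and \<open>D = 0\<close> would make \<open>q\<close>
  rational.\<close>

lemma spanned_by_1_and_irrational:
  fixes q x v w :: complex
  assumes span: "\<And>x. x \<in> K \<Longrightarrow> \<exists>a b. x = of_rat a * v + of_rat b * w"
    and K: "1 \<in> K" "q \<in> K" "x \<in> K" and q: "q \<notin> \<rat>"
  obtains a b where "x = of_rat a + of_rat b * q"
proof -
  obtain a b where 1: "1 = of_rat a * v + of_rat b * w" using span K(1) by blast
  obtain c d where 2: "q = of_rat c * v + of_rat d * w" using span K(2) by blast
  obtain e f where 3: "x = of_rat e * v + of_rat f * w" using span K(3) by blast
  define D where "D = a * d - b * c"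
  have vv: "of_rat D * v = of_rat d - of_rat b * q"
  proof -
    have "of_rat D * v = of_rat d * (of_rat a * v + of_rat b * w) - of_rat b * (of_rat c * v + of_rat d * w)"
      unfolding D_def by (simp add: of_rat_diff of_rat_mult algebra_simps)
    then show ?thesis unfolding 1[symmetric] 2[symmetric] by simp
  qed
  have ww: "of_rat D * w = of_rat a * q - of_rat c"
  proof -
    have "of_rat D * w = of_rat a * (of_rat c * v + of_rat d * w) - of_rat c * (of_rat a * v + of_rat b * w)"
      unfolding D_def by (simp add: of_rat_diff of_rat_mult algebra_simps)
    then show ?thesis unfolding 1[symmetric] 2[symmetric] by simp
  qed
  have "D \<noteq> 0"
  proof
    assume D: "D = 0"
    have "of_rat (- b) * q + of_rat d = 0" "of_rat a * q + of_rat (- c) = 0"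
      using vv ww D by (simp_all add: of_rat_minus)
    then have "a = 0" "b = 0" using rat_of_irrational_relation(1)[OF q] by fastforce+
    then show False using 1 by simp
  qed
  have "of_rat D * x = of_rat e * (of_rat D * v) + of_rat f * (of_rat D * w)"
    unfolding 3 by (simp add: algebra_simps)
  also have "\<dots> = of_rat (e * d - f * c) + of_rat (f * a - e * b) * q"
    unfolding vv ww by (simp add: of_rat_diff of_rat_mult algebra_simps)
  finally have "x = of_rat ((e * d - f * c) / D) + of_rat ((f * a - e * b) / D) * q"
    using \<open>D \<noteq> 0\<close> by (simp add: of_rat_divide field_simps)
  then show ?thesis by (rule that)
qed

lemmas of_rat_simps = of_rat_add of_rat_diff of_rat_minus of_rat_mult of_rat_power

lemma curve_15_Rats:
  fixes q y :: complex
  assumes "q \<in> \<rat>" "y \<in> \<rat>" and eq: "y^2 = (5 * q^2 - 1) * (q^2 + 3)"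
  shows "q^2 = 1"
proof -
  obtain q' y' where q': "q = of_rat q'" "y = of_rat y'" using assms(1,2) by (metis Rats_cases)
  have "of_rat (y'^2) = (of_rat (5 * q'^4 + 14 * q'^2 - 3) :: complex)"
    using eq unfolding q' by (simp add: of_rat_simps power2_eq_square power4_eq_xxxx algebra_simps)
  then have "y'^2 = 5 * q'^4 + 14 * q'^2 - 3" by (simp only: of_rat_eq_iff)
  then have "q'^2 = 1" using curve_15_rat_points by blast
  then show ?thesis unfolding q' by (simp flip: of_rat_power)
qed

lemma curve_17_Rats:
  fixes q z :: complex
  assumes "q \<in> \<rat>" "z \<in> \<rat>" and eq: "z^2 = 5 * q^4 - 8 * q^3 + 6 * q^2 + 8 * q + 5"
  shows "q^2 = 1"
proof -
  obtain q' z' where q': "q = of_rat q'" "z = of_rat z'" using assms(1,2) by (metis Rats_cases)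
  have "of_rat (z'^2) = (of_rat (5 * q'^4 - 8 * q'^3 + 6 * q'^2 + 8 * q' + 5) :: complex)"
    using eq unfolding q' by (simp add: of_rat_simps)
  then have "z'^2 = 5 * q'^4 - 8 * q'^3 + 6 * q'^2 + 8 * q' + 5" by (simp only: of_rat_eq_iff)
  then have "q'^2 = 1" using curve_17_rat_points by blast
  then show ?thesis unfolding q' by (simp flip: of_rat_power)
qed

text \<open>The case \<open>z = b*y\<close>: multiplying by the first quartic turns the product of
  both quartics into the square of \<open>b\<close> times the first.\<close>

lemma curve_product_Rats:
  fixes q :: complex and b :: rat
  assumes "q \<in> \<rat>"
    and eq: "5 * q^4 - 8 * q^3 + 6 * q^2 + 8 * q + 5 = of_rat b^2 * ((5 * q^2 - 1) * (q^2 + 3))"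
  shows "q^2 = 1"
proof -
  obtain q' where q': "q = of_rat q'" using assms(1) by (metis Rats_cases)
  have F1: "(5 * q'^2 - 1) * (q'^2 + 3) = 5 * q'^4 + 14 * q'^2 - 3"
    by (simp add: power2_eq_square power4_eq_xxxx algebra_simps)
  have "of_rat (5 * q'^4 - 8 * q'^3 + 6 * q'^2 + 8 * q' + 5)
      = (of_rat (b^2 * ((5 * q'^2 - 1) * (q'^2 + 3))) :: complex)"
    using eq unfolding q' by (simp add: of_rat_simps)
  then have "5 * q'^4 - 8 * q'^3 + 6 * q'^2 + 8 * q' + 5 = b^2 * (5 * q'^4 + 14 * q'^2 - 3)"
    by (simp only: of_rat_eq_iff F1)
  then have "(5 * q'^4 + 14 * q'^2 - 3) * (5 * q'^4 - 8 * q'^3 + 6 * q'^2 + 8 * q' + 5)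
      = (b * (5 * q'^4 + 14 * q'^2 - 3))^2"
    by (simp only: power2_eq_square mult_ac)
  then have "q'^2 = 1" by (rule curve_product_rat)
  then show ?thesis unfolding q' by (simp flip: of_rat_power)
qed

lemma no_irrational_points:
  fixes q y z :: complex and A B a b a' b' :: rat
  assumes q: "q \<notin> \<rat>" "q^2 = - of_rat A * q - of_rat B"
    and yz: "y = of_rat a + of_rat b * q" "z = of_rat a' + of_rat b' * q"
    and y: "y^2 = (5 * q^2 - 1) * (q^2 + 3)"
    and z: "z^2 = 5 * q^4 - 8 * q^3 + 6 * q^2 + 8 * q + 5"
  shows False
proof -
  have no_root: "q \<noteq> of_rat r" for r using q(1) by auto
  have q2: "q^2 + of_rat A * q + of_rat B = 0" using q(2) by simp
  have nz: "1 + A + B \<noteq> 0"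
  proof
    assume "1 + A + B = 0"
    then have B: "B = - 1 - A" by simp
    have "(q - of_rat 1) * (q - of_rat (- 1 - A)) = 0"
      using q(2) unfolding B by (simp add: of_rat_simps power2_eq_square algebra_simps)
    then show False using no_root by (metis mult_eq_0_iff right_minus_eq)
  qed
  have "y^2 = 5 * q^4 + of_rat 0 * q^3 + of_rat 14 * q^2 - of_rat 0 * q + (11 - of_rat 14)"
    unfolding y by (simp add: power2_eq_square power4_eq_xxxx algebra_simps)
  from irrational_point_relations[OF q yz(1) this] nz
  have "A = 0 \<or> A^2 = (1 + B) * (5 * B - 3)" by (rule curve_15_conjugate_points)
  moreover have "z^2 = 5 * q^4 + of_rat (- 8) * q^3 + of_rat 6 * q^2 - of_rat (- 8) * q + (11 - of_rat 6)"
    unfolding z by (simp add: of_rat_minus)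
  from irrational_point_relations[OF q yz(2) this] nz
  have "B = -1 \<or> A^2 = 4 * A * (B - 1) + (1 + B)^2" by (rule curve_17_conjugate_points)
  ultimately have "A = 0 \<and> B = -1 \<or> B = 1 \<and> A^2 = 4 \<or> A = 1 + B" by (rule conics_intersection)
  \<comment> \<open>The polynomials with these coefficients are \<open>x^2 - 1\<close>, a square of
    \<open>x + 1\<close> or \<open>x - 1\<close>, and \<open>(x + 1)*(x + B)\<close>, all with
    rational roots only.\<close>
  then show False
  proof (elim disjE conjE)
    assume "A = 0" "B = -1"
    then have "(q - of_rat 1) * (q - of_rat (- 1)) = 0"
      using q(2) by (simp add: of_rat_simps power2_eq_square algebra_simps)
    then show False using no_root by (metis mult_eq_0_iff right_minus_eq)
  next
    assume "B = 1" "A^2 = 4"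
    then have "(A - 2) * (A + 2) = 0" by (simp add: power2_eq_square algebra_simps)
    then have "A = 2 \<or> A = -2" by (simp add: add_eq_0_iff2)
    then have "(q - of_rat (- A / 2)) * (q - of_rat (- A / 2)) = 0"
      using q2 \<open>B = 1\<close> by (auto simp: of_rat_simps power2_eq_square algebra_simps)
    then show False using no_root by (metis mult_eq_0_iff right_minus_eq)
  next
    assume A: "A = 1 + B"
    have "(q - of_rat (- 1)) * (q - of_rat (- B)) = 0"
      using q(2) unfolding A by (simp add: of_rat_simps power2_eq_square algebra_simps)
    then show False using no_root by (metis mult_eq_0_iff right_minus_eq)
  qed
qed

lemma square_eq_16_iff: "x^2 = 16 \<longleftrightarrow> x = 4 \<or> x = -4" for x :: complex
  using power2_eq_iff[of x 4] by simp

lemma Y_points_of_square_1: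
  assumes "(q, y, z) \<in> Y K" "q^2 = 1"
  shows "(q, y, z) \<in> {1, -1} \<times> {4, -4} \<times> {4, -4}"
proof -
  have "q = 1 \<or> q = -1" using assms(2) by (simp add: power2_eq_1_iff)
  then have "y^2 = 16" "z^2 = 16" using assms(1) unfolding Y_def by auto
  then show ?thesis using \<open>q = 1 \<or> q = -1\<close> unfolding square_eq_16_iff by auto
qed

lemma Y_quadratic_points:
  assumes "(q, y, z) \<in> points_of_degree_le Y 2"
  shows "q^2 = 1"
proof -
  have y: "y^2 = (5 * q^2 - 1) * (q^2 + 3)" and z: "z^2 = 5 * q^4 - 8 * q^3 + 6 * q^2 + 8 * q + 5"
    using assms unfolding points_of_degree_le_def Y_def by auto
  define K where "K = generate_field complex_field {q, y, z}"
  have "degree_over_Q_le K 2" using assms unfolding points_of_degree_le_def K_def by simp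
  then obtain v w where span: "\<And>x. x \<in> K \<Longrightarrow> \<exists>a b. x = of_rat a * v + of_rat b * w"
    by (rule degree_over_Q_le_2_spanned) blast
  have K: "1 \<in> K" "q \<in> K" "y \<in> K" "z \<in> K"
    using generate_field.one[of complex_field "{q, y, z}"]
    unfolding K_def by (auto intro: generate_field.incl)
  have "q^2 \<in> K"
    using generate_field.eng_mult[of q complex_field "{q, y, z}" q] K(2)
    unfolding K_def by (simp add: power2_eq_square)
  show ?thesis
  proof (cases "q \<in> \<rat>")
    case False
    obtain a b where "y = of_rat a + of_rat b * q"
      using spanned_by_1_and_irrational[OF span K(1,2,3) False] .
    moreover obtain a' b' where "z = of_rat a' + of_rat b' * q"
      using spanned_by_1_and_irrational[OF span K(1,2,4) False] .
    moreover obtain B A where "q^2 = of_rat B + of_rat A * q"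
      using spanned_by_1_and_irrational[OF span K(1,2) \<open>q^2 \<in> K\<close> False] .
    then have "q^2 = - of_rat (- A) * q - of_rat (- B)" by (simp add: of_rat_minus)
    ultimately have False using no_irrational_points[OF False] y z by blast
    then show ?thesis ..
  next
    case True
    show ?thesis
    proof (cases "y \<in> \<rat>")
      assume "y \<in> \<rat>"
      then show ?thesis using curve_15_Rats True y by blast
    next
      assume "y \<notin> \<rat>"
      then obtain a b where ab: "z = of_rat a + of_rat b * y"
        using spanned_by_1_and_irrational[OF span K(1,3,4)] by blast
      \<comment> \<open>This difference is \<open>2*a*b*y\<close>. Its rationality forces
        \<open>a = 0\<close> or \<open>b = 0\<close>, since \<open>y\<close> is irrational.\<close>
      have "z^2 - of_rat a^2 - of_rat b^2 * y^2 \<in> \<rat>" unfolding y z using True by simp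
      then obtain s where "z^2 - of_rat a^2 - of_rat b^2 * y^2 = of_rat s" by (metis Rats_cases)
      then have "of_rat (2 * a * b) * y + of_rat (- s) = 0"
        unfolding ab by (simp add: of_rat_simps power2_eq_square algebra_simps)
      with \<open>y \<notin> \<rat>\<close> have "2 * a * b = 0" by (rule rat_of_irrational_relation)
      then consider "b = 0" | "a = 0" by auto
      then show ?thesis
      proof cases
        case 1
        then have "z \<in> \<rat>" unfolding ab by simp
        then show ?thesis using curve_17_Rats True z by blast
      next
        case 2
        then have "z^2 = of_rat b^2 * y^2" unfolding ab by (simp add: power_mult_distrib)
        then show ?thesis using curve_product_Rats[OF True, of b] unfolding y z by blast
      qed
    qed
  qed
qed

theorem theorem5p18:
  shows "points_of_degree_le Y 2 = Y \<rat> \<and>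
         Y \<rat> = {1, -1} \<times> {4, -4} \<times> {4, -4}"
proof -
  let ?S = "{1, -1} \<times> {4, -4} \<times> {4, -4} :: point set"
  have S_Y: "?S \<subseteq> Y \<rat>" unfolding Y_def by auto
  have Y_points: "Y \<rat> \<subseteq> points_of_degree_le Y 2"
  proof
    fix P assume P: "P \<in> Y \<rat>"
    obtain q y z where qyz: "P = (q, y, z)" by (cases P)
    have rat: "q \<in> \<rat>" "y \<in> \<rat>" "z \<in> \<rat>" using P unfolding qyz Y_def by auto
    then have "residue_field P = \<rat>" unfolding qyz by (simp add: generate_field_Rats)
    moreover have "ring.dimension complex_field 1 \<rat> \<rat>"
      using CC.dimension_one[OF subfield_Rats] .
    ultimately have "degree_over_Q_le (residue_field P) 2"
      unfolding degree_over_Q_le_def by (intro exI[of _ 1]) simp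
    moreover have "P \<in> Y Qbar"
      using P rat unfolding qyz Y_def Qbar_def by (auto intro: rat_imp_algebraic)
    ultimately show "P \<in> points_of_degree_le Y 2" unfolding points_of_degree_le_def by simp
  qed
  have "points_of_degree_le Y 2 \<subseteq> ?S"
  proof
    fix P assume P: "P \<in> points_of_degree_le Y 2"
    obtain q y z where qyz: "P = (q, y, z)" by (cases P)
    have "(q, y, z) \<in> Y Qbar" using P unfolding qyz points_of_degree_le_def by simp
    then show "P \<in> ?S" using Y_points_of_square_1 Y_quadratic_points P unfolding qyz by blast
  qed
  then show ?thesis using S_Y Y_points by blast
qed

end
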